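(* Let $a_0,\dots,a_5\in\mathbb{C}$ and let $$F(s,x_1,x_2)=\det\begin{pmatrix}0&1&\frac{x_1+x_2}{2}&x_1x_2\\ 1&a_0&a_1&a_5-2s\\ \frac{x_1+x_2}{2}&a_1&a_2+s&a_3\\ x_1x_2&a_5-2s&a_3&a_4\end{pmatrix},$$ with $\mathcal D_s(F)(x_1,x_2)=P(x_1)P(x_2)$ and $\mathcal D_{x_2}(F)(s,x_1)=J(s)P(x_1)$, $P$ a quartic polynomial with four distinct zeros and $J$ a cubic polynomial. Let $w_1,w_2$ be the two roots in $s$ of $F(s,x_1,x_2)=0$, and consider the Kowalevski change of variables $(x_1,x_2)\mapsto(w_1,w_2)$, given by $$\frac{dx_1}{\sqrt{P(x_1)}}+\frac{dx_2}{\sqrt{P(x_2)}}=\frac{dw_1}{\sqrt{J(w_1)}},\qquad \frac{dx_1}{\sqrt{P(x_1)}}-\frac{dx_2}{\sqrt{P(x_2)}}=\frac{dw_2}{\sqrt{J(w_2)}}$$ (for suitable branches of the square roots and ordering of $w_1,w_2$). Then the Kowalevski change of variables is the infinitesimal form of the action of the two-valued coset group $(\Gamma_2,\mathbb Z_2)$ on $\Gamma_1:\ y^2=P(x)$, i.e. these differential relations are the differential form of the correspondence $F(w,x_1,x_2)=0$ which defines this action; and, up to fractional-linear transformations, it is the operation of the two-valued group $(\Gamma_2,\mathbb Z_2)$: there are a fractional-linear transformation $\hat\psi$ and an affine transformation $\gamma$ such that, writing $x_i=\hat\psi(\xi_i)$ and $w_i=\gamma(\omega_i)$, one has $[\ome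ga_1,\omega_2]=\xi_1*_c\xi_2$.
   Context: $\mathcal D_y$ denotes the discriminant with respect to $y$ ($b^2-4ac$ for $ay^2+by+c$). $\Gamma_2:\ t^2=J(s)$; after an affine change of $s$ it is put in the canonical form $t^2=J'(m)=4m^3-g_2m-g_3$, an elliptic curve with unit at infinity. The two-valued coset group $(\Gamma_2,\mathbb Z_2)$ is $\mathbb{CP}^1=\Gamma_2/\{\pm1\}$ with operation sending the classes of $A,B\in\Gamma_2$ to the unordered pair of classes of $A+B$ and $A-B$; for distinct finite arguments, $$\xi_1*_c\xi_2=\left[-\xi_1-\xi_2+\left(\tfrac{t_1-t_2}{2(\xi_1-\xi_2)}\right)^2,\ -\xi_1-\xi_2+\left(\tfrac{t_1+t_2}{2(\xi_1-\xi_2)}\right)^2\right],\quad t_i^2=J'(\xi_i).$$ Its action on $\Gamma_1$ (on the $x$-coordinate of points of $\Gamma_1$) sends a pencil parameter $s$ and a value $x_1$ to the pair of solutions $x_2$ of $F(s,x_1,x_2)=0$. *)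

theory Defs
  imports "HOL-Analysis.Analysis" "HOL-Computational_Algebra.Polynomial" "HOL-Library.Multiset"
begin

definition discriminant :: "(complex \<Rightarrow> complex) \<Rightarrow> complex" where
  "discriminant f =
     (THE d. \<exists>A B C. (\<forall>y. f y = A * y\<^sup>2 + B * y + C) \<and> d = B\<^sup>2 - 4 * A * C)"

lemma discriminant_quadratic:
  assumes "\<And>y. f y = A * y\<^sup>2 + B * y + C"
  shows "discriminant f = B\<^sup>2 - 4 * A * C"
  unfolding discriminant_def
proof (rule the_equality)
  show "\<exists>A' B' C'. (\<forall>y. f y = A' * y\<^sup>2 + B' * y + C') \<and>
      B\<^sup>2 - 4 * A * C = B'\<^sup>2 - 4 * A' * C'"
    using assms by blast
next
  fix d
  assume "\<exists>A' B' C'. (\<forall>y. f y = A' * y\<^sup>2 + B' * y + C') \<and> d = B'\<^sup>2 - 4 * A' * C'"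
  then obtain A' B' C' where f': "\<And>y. f y = A' * y\<^sup>2 + B' * y + C'"
    and d: "d = B'\<^sup>2 - 4 * A' * C'"
    by blast
  have eq: "A * y\<^sup>2 + B * y + C = A' * y\<^sup>2 + B' * y + C'" for y
    using assms f' by metis
  have C: "C = C'" using eq[of 0] by simp
  have 1: "A + B = A' + B'" using eq[of 1] C by simp
  have 2: "A - B = A' - B'" using eq[of "-1"] C by simp
  have "2 * A = 2 * A'" using arg_cong2[of _ _ _ _ "(+)", OF 1 2] by simp
  then have "A = A'" by simp
  with 1 C d show "d = B\<^sup>2 - 4 * A * C" by simp
qed


section \<open>The complex projective line\<close>

datatype cp1 = Fin complex | Infty

text \<open>Homogeneous coordinates \<open>(hnum p : hden p)\<close>.\<close>

fun hnum :: "cp1 \<Rightarrow> complex" where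
  "hnum (Fin z) = z" | "hnum Infty = 1"

fun hden :: "cp1 \<Rightarrow> complex" where
  "hden (Fin z) = 1" | "hden Infty = 0"

text \<open>\<open>root_pair q R\<close>: the binary quadratic form \<open>q\<close> is nonzero, and \<open>R\<close> is the multiset of its
  two zeros on the projective line (\<open>Infty\<close> is a zero whenever the degree drops).\<close>

definition root_pair :: "(complex \<Rightarrow> complex \<Rightarrow> complex) \<Rightarrow> cp1 multiset \<Rightarrow> bool" where
  "root_pair q R \<longleftrightarrow>
     (\<exists>p p' k. R = {#p, p'#} \<and> k \<noteq> 0 \<and>
        (\<forall>X Y. q X Y = k * (X * hden p - Y * hnum p) * (X * hden p' - Y * hnum p')))"

fun moebius :: "complex \<Rightarrow> complex \<Rightarrow> complex \<Rightarrow> complex \<Rightarrow> cp1 \<Rightarrow> cp1" where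
  "moebius A B C D (Fin z) = (if C * z + D = 0 then Infty else Fin ((A * z + B) / (C * z + D)))"
| "moebius A B C D Infty = (if C = 0 then Infty else Fin (A / C))"

definition fractional_linear :: "(cp1 \<Rightarrow> cp1) \<Rightarrow> bool" where
  "fractional_linear \<psi> \<longleftrightarrow> (\<exists>A B C D. A * D - B * C \<noteq> 0 \<and> \<psi> = moebius A B C D)"

fun affine_map :: "complex \<Rightarrow> complex \<Rightarrow> cp1 \<Rightarrow> cp1" where
  "affine_map \<alpha> \<beta> (Fin z) = Fin (\<alpha> * z + \<beta>)"
| "affine_map \<alpha> \<beta> Infty = Infty"


section \<open>The polynomial F\<close>

definition kowF :: "(nat \<Rightarrow> complex) \<Rightarrow> complex \<Rightarrow> complex \<Rightarrow> complex \<Rightarrow> complex" where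
  "kowF a s x1 x2 = det (vector
     [vector [0, 1, (x1 + x2) / 2, x1 * x2],
      vector [1, a 0, a 1, a 5 - 2 * s],
      vector [(x1 + x2) / 2, a 1, a 2 + s, a 3],
      vector [x1 * x2, a 5 - 2 * s, a 3, a 4]] :: complex^4^4)"

text \<open>The homogenization of \<open>kowF\<close>, of degree 2 in each of the pairs \<open>(s, t)\<close>, \<open>(x1, y1)\<close>,
  \<open>(x2, y2)\<close>; it makes sense of \<open>F = 0\<close> when some of the three arguments are infinite.\<close>

definition kowF_hom :: "(nat \<Rightarrow> complex) \<Rightarrow> complex \<Rightarrow> complex \<Rightarrow> complex \<Rightarrow> complex \<Rightarrow>
    complex \<Rightarrow> complex \<Rightarrow> complex" where
  "kowF_hom a s t x1 y1 x2 y2 = det (vector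
     [vector [0, y1 * y2, (x1 * y2 + x2 * y1) / 2, x1 * x2],
      vector [y1 * y2, t * a 0, t * a 1, t * a 5 - 2 * s],
      vector [(x1 * y2 + x2 * y1) / 2, t * a 1, t * a 2 + s, t * a 3],
      vector [x1 * x2, t * a 5 - 2 * s, t * a 3, t * a 4]] :: complex^4^4)"

lemma kowF_hom_finite: "kowF_hom a s 1 x1 1 x2 1 = kowF a s x1 x2"
  by (simp add: kowF_hom_def kowF_def)

text \<open>The pair of roots of \<open>F\<close> in \<open>s\<close>.\<close>

definition kow_roots :: "(nat \<Rightarrow> complex) \<Rightarrow> cp1 \<Rightarrow> cp1 \<Rightarrow> cp1 multiset \<Rightarrow> bool" where
  "kow_roots a x1 x2 R \<longleftrightarrow>
     root_pair (\<lambda>S T. kowF_hom a S T (hnum x1) (hden x1) (hnum x2) (hden x2)) R"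

text \<open>The action of the two-valued coset group: the pencil parameter \<open>s\<close> sends \<open>x1\<close> to the pair
  of roots of \<open>F\<close> in \<open>x2\<close>.\<close>

definition coset_action :: "(nat \<Rightarrow> complex) \<Rightarrow> cp1 \<Rightarrow> cp1 \<Rightarrow> cp1 multiset \<Rightarrow> bool" where
  "coset_action a s x1 R \<longleftrightarrow>
     root_pair (\<lambda>X Y. kowF_hom a (hnum s) (hden s) (hnum x1) (hden x1) X Y) R"


section \<open>The two-valued coset group of an elliptic curve\<close>

text \<open>Points of the curve \<open>t\<^sup>2 = 4 m\<^sup>3 - g2 m - g3\<close>; \<open>None\<close> is the point at infinity,
  the unit of the group law.\<close>

type_synonym point = "(complex \<times> complex) option"

definition canonical_cubic :: "complex \<Rightarrow> complex \<Rightarrow> complex \<Rightarrow> complex" where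
  "canonical_cubic g2 g3 m = 4 * m ^ 3 - g2 * m - g3"

definition ecurve :: "complex \<Rightarrow> complex \<Rightarrow> point set" where
  "ecurve g2 g3 = insert None {Some (m, t) | m t. t\<^sup>2 = canonical_cubic g2 g3 m}"

fun eneg :: "point \<Rightarrow> point" where
  "eneg None = None"
| "eneg (Some (m, t)) = Some (m, - t)"

text \<open>Chord and tangent addition. The line of slope \<open>l\<close> through the two points meets the curve in
  a third point whose abscissa is determined by \<open>m1 + m2 + m = l\<^sup>2 / 4\<close>.\<close>

fun eadd :: "complex \<Rightarrow> point \<Rightarrow> point \<Rightarrow> point" where
  "eadd g2 None B = B"
| "eadd g2 A None = A"
| "eadd g2 (Some (m1, t1)) (Some (m2, t2)) =
     (if m1 = m2 \<and> t1 = - t2 then None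
      else let l = (if m1 = m2 then (12 * m1\<^sup>2 - g2) / (2 * t1) else (t1 - t2) / (m1 - m2));
               m = - m1 - m2 + (l / 2)\<^sup>2
           in Some (m, - (t1 + l * (m - m1))))"

text \<open>The class of a point modulo \<open>{\<plusminus>1}\<close>.\<close>

fun eclass :: "point \<Rightarrow> cp1" where
  "eclass None = Infty"
| "eclass (Some (m, t)) = Fin m"

definition erep :: "complex \<Rightarrow> complex \<Rightarrow> cp1 \<Rightarrow> point" where
  "erep g2 g3 \<xi> = (SOME A. A \<in> ecurve g2 g3 \<and> eclass A = \<xi>)"

definition coset_op :: "complex \<Rightarrow> complex \<Rightarrow> cp1 \<Rightarrow> cp1 \<Rightarrow> cp1 multiset" where
  "coset_op g2 g3 \<xi> \<eta> =
     (let A = erep g2 g3 \<xi>; B = erep g2 g3 \<eta>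
      in {# eclass (eadd g2 A B), eclass (eadd g2 A (eneg B)) #})"

lemma erep: "erep g2 g3 \<xi> \<in> ecurve g2 g3" "eclass (erep g2 g3 \<xi>) = \<xi>"
proof -
  have "\<exists>A. A \<in> ecurve g2 g3 \<and> eclass A = \<xi>"
  proof (cases \<xi>)
    case (Fin m)
    have "Some (m, csqrt (canonical_cubic g2 g3 m)) \<in> ecurve g2 g3"
      by (simp add: ecurve_def)
    then show ?thesis using Fin by force
  next
    case Infty
    then show ?thesis by (force simp: ecurve_def)
  qed
  then have "erep g2 g3 \<xi> \<in> ecurve g2 g3 \<and> eclass (erep g2 g3 \<xi>) = \<xi>"
    unfolding erep_def by (rule someI_ex)
  then show "erep g2 g3 \<xi> \<in> ecurve g2 g3" "eclass (erep g2 g3 \<xi>) = \<xi>"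
    by auto
qed

lemma eneg_eneg [simp]: "eneg (eneg A) = A"
  by (cases A rule: eneg.cases) auto

lemma eclass_eneg [simp]: "eclass (eneg A) = eclass A"
  by (cases A rule: eneg.cases) auto

lemma eclass_eq_imp:
  assumes "A \<in> ecurve g2 g3" "A' \<in> ecurve g2 g3" "eclass A = eclass A'"
  shows "A' = A \<or> A' = eneg A"
  using assms
  by (auto simp: ecurve_def) (metis add.inverse_inverse power2_eq_iff)+

lemma eadd_eneg_eneg: "eadd g2 (eneg A) (eneg B) = eneg (eadd g2 A B)"
proof (cases A)
  case A: (Some a)
  show ?thesis
  proof (cases B)
    case B: (Some b)
    obtain m1 t1 m2 t2 where ab: "a = (m1, t1)" "b = (m2, t2)"
      by (cases a, cases b) auto
    have slope: "(t2 - t1) / (m1 - m2) = - ((t1 - t2) / (m1 - m2))"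
      by (metis minus_diff_eq minus_divide_left)
    show ?thesis
      using equation_minus_iff[of t1 t2]
      by (auto simp: A B ab Let_def slope minus_equation_iff[of t1 t2] simp flip: minus_divide_right)
  qed (cases a, simp add: A)
qed simp

text \<open>The operation does not depend on the chosen representatives.\<close>

lemma coset_op_eclass:
  assumes "A \<in> ecurve g2 g3" "B \<in> ecurve g2 g3"
  shows "coset_op g2 g3 (eclass A) (eclass B) =
           {# eclass (eadd g2 A B), eclass (eadd g2 A (eneg B)) #}"
proof -
  have A: "erep g2 g3 (eclass A) = A \<or> erep g2 g3 (eclass A) = eneg A"
    using eclass_eq_imp[OF assms(1) erep(1)] erep(2) by metis
  have B: "erep g2 g3 (eclass B) = B \<or> erep g2 g3 (eclass B) = eneg B"
    using eclass_eq_imp[OF assms(2) erep(1)] erep(2) by metis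
  have "eclass (eadd g2 (eneg A) B) = eclass (eadd g2 A (eneg B))"
    using eadd_eneg_eneg[of g2 A "eneg B"] by simp
  moreover have "eclass (eadd g2 (eneg A) (eneg B)) = eclass (eadd g2 A B)"
    by (simp add: eadd_eneg_eneg)
  ultimately show ?thesis
    using A B by (auto simp: coset_op_def Let_def add_mset_commute)
qed

lemma coset_op_finite:
  assumes "\<xi>1 \<noteq> \<xi>2" "t1\<^sup>2 = canonical_cubic g2 g3 \<xi>1" "t2\<^sup>2 = canonical_cubic g2 g3 \<xi>2"
  shows "coset_op g2 g3 (Fin \<xi>1) (Fin \<xi>2) =
    {# Fin (- \<xi>1 - \<xi>2 + ((t1 - t2) / (2 * (\<xi>1 - \<xi>2)))\<^sup>2),
       Fin (- \<xi>1 - \<xi>2 + ((t1 + t2) / (2 * (\<xi>1 - \<xi>2)))\<^sup>2) #}"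
  using coset_op_eclass[of "Some (\<xi>1, t1)" g2 g3 "Some (\<xi>2, t2)"] assms
  by (simp add: ecurve_def Let_def mult.commute)


section \<open>The Kowalevski change of variables\<close>

definition sqrt_branch :: "complex poly \<Rightarrow> complex set \<Rightarrow> (complex \<Rightarrow> complex) \<Rightarrow> bool" where
  "sqrt_branch Q V r \<longleftrightarrow>
     open V \<and> r holomorphic_on V \<and> (\<forall>z\<in>V. r z \<noteq> 0 \<and> (r z)\<^sup>2 = poly Q z)"

text \<open>The forms \<open>dx1 / sqrt (P x1) \<plusminus> dx2 / sqrt (P x2)\<close> at the point \<open>(x1, x2)\<close>, evaluated on the
  tangent vector \<open>(h1, h2)\<close>.\<close>

type_synonym form = "complex \<Rightarrow> complex \<Rightarrow> complex \<Rightarrow> complex \<Rightarrow> complex"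

definition form_plus :: "(complex \<Rightarrow> complex) \<Rightarrow> (complex \<Rightarrow> complex) \<Rightarrow> form" where
  "form_plus r1 r2 x1 x2 h1 h2 = h1 / r1 x1 + h2 / r2 x2"

definition form_minus :: "(complex \<Rightarrow> complex) \<Rightarrow> (complex \<Rightarrow> complex) \<Rightarrow> form" where
  "form_minus r1 r2 x1 x2 h1 h2 = h1 / r1 x1 - h2 / r2 x2"

text \<open>The relation \<open>\<theta> = dw / sqrt (J w)\<close> at \<open>(x1, x2)\<close>, with \<open>q\<close> the branch of \<open>sqrt J\<close>.\<close>

definition differential_relation ::
    "form \<Rightarrow> (complex \<Rightarrow> complex) \<Rightarrow> (complex \<times> complex \<Rightarrow> complex) \<Rightarrow> complex \<Rightarrow> complex \<Rightarrow> bool" where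
  "differential_relation \<theta> q w x1 x2 \<longleftrightarrow>
     (\<exists>D. (w has_derivative D) (at (x1, x2)) \<and>
          (\<forall>h1 h2. \<theta> x1 x2 h1 h2 = D (h1, h2) / q (w (x1, x2))))"

definition kowalevski_change ::
    "(nat \<Rightarrow> complex) \<Rightarrow> complex poly \<Rightarrow> complex poly \<Rightarrow>
     complex set \<Rightarrow> complex set \<Rightarrow> complex set \<Rightarrow> complex set \<Rightarrow>
     (complex \<Rightarrow> complex) \<Rightarrow> (complex \<Rightarrow> complex) \<Rightarrow> (complex \<Rightarrow> complex) \<Rightarrow> (complex \<Rightarrow> complex) \<Rightarrow>
     (complex \<times> complex \<Rightarrow> complex) \<Rightarrow> (complex \<times> complex \<Rightarrow> complex) \<Rightarrow> bool" where
  "kowalevski_change a P J V1 V2 W1 W2 r1 r2 q1 q2 w1 w2 \<longleftrightarrow>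
     sqrt_branch P V1 r1 \<and> sqrt_branch P V2 r2 \<and> sqrt_branch J W1 q1 \<and> sqrt_branch J W2 q2 \<and>
     (\<forall>x1\<in>V1. \<forall>x2\<in>V2.
        w1 (x1, x2) \<in> W1 \<and> w2 (x1, x2) \<in> W2 \<and>
        kow_roots a (Fin x1) (Fin x2) {# Fin (w1 (x1, x2)), Fin (w2 (x1, x2)) #} \<and>
        differential_relation (form_plus r1 r2) q1 w1 x1 x2 \<and>
        differential_relation (form_minus r1 r2) q2 w2 x1 x2)"

text \<open>On \<open>W \<times> V1 \<times> V2\<close> the graph of the action is the graph of \<open>w\<close>, and along it the differential
  of \<open>F\<close> is a nonvanishing multiple of \<open>\<theta> - ds / sqrt (J s)\<close>; that is, \<open>\<theta> = ds / sqrt (J s)\<close> is the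
  differential form of the correspondence \<open>F(s, x1, x2) = 0\<close> defining the action.\<close>

definition infinitesimal_form_of_action ::
    "(nat \<Rightarrow> complex) \<Rightarrow> complex set \<Rightarrow> complex set \<Rightarrow> complex set \<Rightarrow>
     form \<Rightarrow> (complex \<Rightarrow> complex) \<Rightarrow> (complex \<times> complex \<Rightarrow> complex) \<Rightarrow> bool" where
  "infinitesimal_form_of_action a V1 V2 W \<theta> q w \<longleftrightarrow>
     (\<forall>x1\<in>V1. \<forall>x2\<in>V2. \<forall>s\<in>W.
        ((\<exists>R. coset_action a (Fin s) (Fin x1) R \<and> Fin x2 \<in># R) \<longleftrightarrow> s = w (x1, x2)) \<and>
        (s = w (x1, x2) \<longrightarrow>
          (\<exists>\<kappa>. \<kappa> \<noteq> 0 \<and>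
             ((\<lambda>(s, x1, x2). kowF a s x1 x2) has_derivative
                (\<lambda>(k, h1, h2). \<kappa> * (\<theta> x1 x2 h1 h2 - k / q s))) (at (s, x1, x2)))))"

end

theory Submission
  imports Defs
begin

text \<open>
  Write \<open>F\<close> as minus the quadratic form \<open>v\<^sup>T adj(M) v\<close> with \<open>v = (1, (x1 + x2)/2, x1 x2)\<close> and \<open>M\<close> the
  symmetric \<open>3 \<times> 3\<close> block of the bordered matrix, which is linear in \<open>s\<close>. The points \<open>v\<close> parametrize
  the plane by pairs of tangents of a fixed conic, and \<open>F = 0\<close> says that \<open>v\<close> lies on the conic \<open>s\<close> of
  a tangential pencil. Both discriminants are then explicit: \<open>pencil_quartic a x1 *
  pencil_quartic a x2\<close> in \<open>s\<close> and \<open>pencil_cubic a s * pencil_quartic a x1\<close> in \<open>x2\<close>, the cubic being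
  \<open>- det M\<close>. Hence \<open>P\<close> and \<open>J\<close> are these polynomials up to one common sign \<open>\<epsilon>\<close>.

  The change of variables. For a quadratic polynomial the square of the derivative at a root is the
  discriminant. So on the surface \<open>F = 0\<close> one has \<open>(F\<^sub>s)\<^sup>2 = P(x1) P(x2)\<close>, \<open>(F\<^sub>1)\<^sup>2 = J(s) P(x2)\<close> and
  \<open>(F\<^sub>2)\<^sup>2 = J(s) P(x1)\<close>, where \<open>F\<^sub>i\<close> is the derivative in \<open>xi\<close>. Dividing \<open>F\<^sub>s ds + F\<^sub>1 dx1 + F\<^sub>2 dx2\<close>
  by \<open>sqrt (P(x1) P(x2) J(s))\<close> turns it into a combination of \<open>dx1 / sqrt P(x1)\<close>, \<open>dx2 / sqrt P(x2)\<close>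
  and \<open>ds / sqrt J(s)\<close> with coefficients \<open>\<plusminus>1\<close>. The relative sign of the two \<open>dx\<close> terms is that of
  \<open>F\<^sub>1 F\<^sub>2\<close>, and \<open>kow_dx_mult\<close> computes this product on \<open>F = 0\<close> as \<open>- \<epsilon> J(s) F\<^sub>s\<close>. As \<open>F\<^sub>s\<close> takes
  opposite values at the two roots in \<open>s\<close>, one root belongs to the sum of the two forms and the other
  one to the difference (\<open>kowalevski_branch\<close>).

  The group operation. On \<open>t\<^sup>2 = 4 m\<^sup>3 - g2 m - g3\<close> three classes \<open>x1, x2, s\<close> satisfy
  \<open>s \<in> x1 * x2\<close> exactly when the symmetric polynomial \<open>addition_form\<close> vanishes
  (\<open>coset_op_root_pair\<close>). The unit of the group lies at infinity, so a fractional-linear map should send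
  infinity to a zero \<open>c\<close> of \<open>P\<close>. Moving \<open>c\<close> to infinity by \<open>x = c + 1/y\<close> carries \<open>F\<close> to another
  polynomial of the same shape with \<open>a 0 = 0\<close> (\<open>kowF_hom_recentred\<close>), and then affine
  substitutions in \<open>y\<close> and \<open>s\<close> carry it to a multiple of \<open>addition_form\<close> (\<open>kowF_hom_canonical\<close>).
  Homogeneous coordinates make all of this valid at infinite arguments too. The symmetry of
  \<open>addition_form\<close> gives the action of \<open>s\<close> on \<open>x1\<close> together with the roots in \<open>s\<close>.
\<close>

section \<open>F as a quadratic form\<close>

lemma vector_4:
  "(vector [w,x,y,z] ::('a::zero)^4)$1 = w"
  "(vector [w,x,y,z] ::('a::zero)^4)$2 = x"
  "(vector [w,x,y,z] ::('a::zero)^4)$3 = y"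
  "(vector [w,x,y,z] ::('a::zero)^4)$4 = z"
  unfolding vector_def by simp_all

lemma det_4:
  "det (A::'a::comm_ring_1^4^4) =
     A$1$1 * (A$2$2 * (A$3$3 * A$4$4 - A$3$4 * A$4$3) - A$2$3 * (A$3$2 * A$4$4 - A$3$4 * A$4$2)
            + A$2$4 * (A$3$2 * A$4$3 - A$3$3 * A$4$2))
   - A$1$2 * (A$2$1 * (A$3$3 * A$4$4 - A$3$4 * A$4$3) - A$2$3 * (A$3$1 * A$4$4 - A$3$4 * A$4$1)
            + A$2$4 * (A$3$1 * A$4$3 - A$3$3 * A$4$1))
   + A$1$3 * (A$2$1 * (A$3$2 * A$4$4 - A$3$4 * A$4$2) - A$2$2 * (A$3$1 * A$4$4 - A$3$4 * A$4$1)
            + A$2$4 * (A$3$1 * A$4$2 - A$3$2 * A$4$1))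
   - A$1$4 * (A$2$1 * (A$3$2 * A$4$3 - A$3$3 * A$4$2) - A$2$2 * (A$3$1 * A$4$3 - A$3$3 * A$4$1)
            + A$2$3 * (A$3$1 * A$4$2 - A$3$2 * A$4$1))"
proof -
  have f: "finite {2::4, 3, 4}" "finite {3::4, 4}" "finite {4::4}" by auto
  have n: "1 \<notin> {2::4, 3, 4}" "2 \<notin> {3::4, 4}" "3 \<notin> {4::4}" by auto
  show ?thesis
    unfolding det_def UNIV_4
    unfolding sum_over_permutations_insert[OF f(1) n(1)]
    unfolding sum_over_permutations_insert[OF f(2) n(2)]
    unfolding sum_over_permutations_insert[OF f(3) n(3)]
    unfolding permutes_sing
    by (simp add: sign_swap_id permutation_swap_id sign_compose permutation_compose sign_id swap_id_eq algebra_simps)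
qed

lemma det_bordered_symmetric:
  fixes p q r :: "'a::comm_ring_1"
  shows "det (vector [vector [0, p, q, r], vector [p, m11, m12, m13],
                      vector [q, m12, m22, m23], vector [r, m13, m23, m33]] :: 'a^4^4) =
    - (p\<^sup>2 * (m22 * m33 - m23\<^sup>2) + q\<^sup>2 * (m11 * m33 - m13\<^sup>2) + r\<^sup>2 * (m11 * m22 - m12\<^sup>2)
       + 2 * p * q * (m13 * m23 - m12 * m33) + 2 * p * r * (m12 * m23 - m13 * m22)
       + 2 * q * r * (m12 * m13 - m11 * m23))"
  unfolding det_4 vector_4 by (simp add: algebra_simps power2_eq_square)

text \<open>The value of \<open>4 F\<close> in terms of \<open>p = y1 y2\<close>, \<open>q = x1 y2 + x2 y1\<close> and \<open>r = x1 x2\<close>. The factor 4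
  removes the halves from the bordered matrix, so that all the identities below are over the integers.\<close>

definition kow_form ::
    "(nat \<Rightarrow> complex) \<Rightarrow> complex \<Rightarrow> complex \<Rightarrow> complex \<Rightarrow> complex \<Rightarrow> complex \<Rightarrow> complex" where
  "kow_form a s t p q r =
    - (4 * p\<^sup>2 * ((t * a 2 + s) * (t * a 4) - (t * a 3)\<^sup>2)
       + q\<^sup>2 * (t * a 0 * (t * a 4) - (t * a 5 - 2 * s)\<^sup>2)
       + 4 * r\<^sup>2 * (t * a 0 * (t * a 2 + s) - (t * a 1)\<^sup>2)
       + 4 * p * q * ((t * a 5 - 2 * s) * (t * a 3) - t * a 1 * (t * a 4))
       + 8 * p * r * (t * a 1 * (t * a 3) - (t * a 5 - 2 * s) * (t * a 2 + s))
       + 4 * q * r * (t * a 1 * (t * a 5 - 2 * s) - t * a 0 * (t * a 3)))"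

lemma kowF_hom_eq_form:
  "4 * kowF_hom a s t x1 y1 x2 y2 = kow_form a s t (y1 * y2) (x1 * y2 + x2 * y1) (x1 * x2)"
proof -
  define q where "q = (x1 * y2 + x2 * y1) / 2"
  have q: "x1 * y2 + x2 * y1 = 2 * q" by (simp add: q_def)
  show ?thesis
    unfolding kowF_hom_def det_bordered_symmetric kow_form_def q_def[symmetric] unfolding q by algebra
qed

lemma kowF_eq_form: "4 * kowF a s x1 x2 = kow_form a s 1 1 (x1 + x2) (x1 * x2)"
  using kowF_hom_eq_form[of a s 1 x1 1 x2 1] by (simp add: kowF_hom_finite)

lemma kowF_sym: "kowF a s x1 x2 = kowF a s x2 x1"
  by (rule mult_left_cancel[THEN iffD1, of 4]) (simp_all only: kowF_eq_form add.commute mult.commute, simp)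

lemma kowF_hom_scale:
  "kowF_hom a s t (c1 * x1) (c1 * y1) (c2 * x2) (c2 * y2) = c1\<^sup>2 * c2\<^sup>2 * kowF_hom a s t x1 y1 x2 y2"
proof -
  have "kow_form a s t (c1 * y1 * (c2 * y2)) (c1 * x1 * (c2 * y2) + c2 * x2 * (c1 * y1)) (c1 * x1 * (c2 * x2))
    = c1\<^sup>2 * c2\<^sup>2 * kow_form a s t (y1 * y2) (x1 * y2 + x2 * y1) (x1 * x2)"
    unfolding kow_form_def by algebra
  then have "4 * kowF_hom a s t (c1 * x1) (c1 * y1) (c2 * x2) (c2 * y2) = 4 * (c1\<^sup>2 * c2\<^sup>2 * kowF_hom a s t x1 y1 x2 y2)"
    unfolding kowF_hom_eq_form[symmetric] by (simp only: mult.left_commute)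
  then show ?thesis by simp
qed

lemma kowF_hom_scale_s:
  "kowF_hom a (c * s) (c * t) x1 y1 x2 y2 = c\<^sup>2 * kowF_hom a s t x1 y1 x2 y2"
proof -
  have "kow_form a (c * s) (c * t) p q r = c\<^sup>2 * kow_form a s t p q r" for p q r
    unfolding kow_form_def by algebra
  then have "4 * kowF_hom a (c * s) (c * t) x1 y1 x2 y2 = 4 * (c\<^sup>2 * kowF_hom a s t x1 y1 x2 y2)"
    unfolding mult.left_commute[of 4] kowF_hom_eq_form .
  then show ?thesis by simp
qed

section \<open>The two discriminants\<close>

text \<open>The value of the quadratic form \<open>M\<close> on the tangent line \<open>(x\<^sup>2, - 2 x, 1)\<close> of the fixed conic. The
  \<open>s\<close>-part of \<open>M\<close> is the dual of that conic, which is why \<open>s\<close> cancels here.\<close>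

definition pencil_quartic :: "(nat \<Rightarrow> complex) \<Rightarrow> complex \<Rightarrow> complex" where
  "pencil_quartic a x = a 0 * x ^ 4 - 4 * a 1 * x ^ 3 + (4 * a 2 + 2 * a 5) * x\<^sup>2 - 4 * a 3 * x + a 4"

text \<open>Minus the determinant of the \<open>3 \<times> 3\<close> block \<open>M\<close>; its leading coefficient is 4.\<close>

definition pencil_cubic :: "(nat \<Rightarrow> complex) \<Rightarrow> complex \<Rightarrow> complex" where
  "pencil_cubic a s = - (a 0 * ((a 2 + s) * a 4 - (a 3)\<^sup>2) + a 1 * ((a 5 - 2 * s) * a 3 - a 1 * a 4)
      + (a 5 - 2 * s) * (a 1 * a 3 - (a 5 - 2 * s) * (a 2 + s)))"

definition kow_linear :: "(nat \<Rightarrow> complex) \<Rightarrow> complex \<Rightarrow> complex \<Rightarrow> complex" where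
  "kow_linear a x1 x2 = - (a 4 + a 5 * (x1 + x2)\<^sup>2 + a 0 * (x1 * x2)\<^sup>2 - 2 * a 3 * (x1 + x2)
      - 2 * (a 5 - 2 * a 2) * (x1 * x2) - 2 * a 1 * (x1 + x2) * (x1 * x2))"

lemma kowF_hom_quadratic_s:
  "kowF_hom a s t x1 1 x2 1 = (x1 - x2)\<^sup>2 * s\<^sup>2 + kow_linear a x1 x2 * s * t + kowF a 0 x1 x2 * t\<^sup>2"
proof -
  have "4 * kowF_hom a s t x1 1 x2 1 = 4 * ((x1 - x2)\<^sup>2 * s\<^sup>2 + kow_linear a x1 x2 * s * t) + (4 * kowF a 0 x1 x2) * t\<^sup>2"
    unfolding kowF_eq_form kowF_hom_eq_form kow_form_def kow_linear_def power_one mult_1 mult_1_right by algebra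
  also have "\<dots> = 4 * ((x1 - x2)\<^sup>2 * s\<^sup>2 + kow_linear a x1 x2 * s * t + kowF a 0 x1 x2 * t\<^sup>2)"
    by (simp only: distrib_left mult.assoc)
  finally show ?thesis by (rule mult_left_cancel[THEN iffD1, rotated]) simp
qed

lemma kowF_quadratic_s:
  "kowF a s x1 x2 = (x1 - x2)\<^sup>2 * s\<^sup>2 + kow_linear a x1 x2 * s + kowF a 0 x1 x2"
  using kowF_hom_quadratic_s[of a s 1 x1 x2] by (simp add: kowF_hom_finite)

lemma kow_linear_discriminant:
  "(kow_linear a x1 x2)\<^sup>2 - 4 * (x1 - x2)\<^sup>2 * kowF a 0 x1 x2
    = pencil_quartic a x1 * pencil_quartic a x2"
proof -
  have "(kow_linear a x1 x2)\<^sup>2 - (x1 - x2)\<^sup>2 * (4 * kowF a 0 x1 x2)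
      = pencil_quartic a x1 * pencil_quartic a x2"
    unfolding kowF_eq_form kow_form_def kow_linear_def pencil_quartic_def
      power_one mult_1 mult_1_right by algebra
  then show ?thesis by (simp only: mult.assoc mult.left_commute)
qed

lemma discriminant_kowF_s:
  "discriminant (\<lambda>s. kowF a s x1 x2) = pencil_quartic a x1 * pencil_quartic a x2"
  using discriminant_quadratic[of "\<lambda>s. kowF a s x1 x2", OF kowF_quadratic_s]
  by (simp only: kow_linear_discriminant)

text \<open>Like \<open>kow_form\<close>, this and the next two are four times the coefficients of \<open>F\<close> in \<open>x2\<close>.\<close>

definition kow_coeff2 :: "(nat \<Rightarrow> complex) \<Rightarrow> complex \<Rightarrow> complex \<Rightarrow> complex" where
  "kow_coeff2 a s x = - ((a 0 * a 4 - (a 5 - 2 * s)\<^sup>2) + 4 * x\<^sup>2 * (a 0 * (a 2 + s) - (a 1)\<^sup>2)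
       + 4 * x * (a 1 * (a 5 - 2 * s) - a 0 * a 3))"

definition kow_coeff1 :: "(nat \<Rightarrow> complex) \<Rightarrow> complex \<Rightarrow> complex \<Rightarrow> complex" where
  "kow_coeff1 a s x = - (2 * x * (a 0 * a 4 - (a 5 - 2 * s)\<^sup>2)
       + 4 * ((a 5 - 2 * s) * a 3 - a 1 * a 4)
       + 8 * x * (a 1 * a 3 - (a 5 - 2 * s) * (a 2 + s))
       + 4 * x\<^sup>2 * (a 1 * (a 5 - 2 * s) - a 0 * a 3))"

definition kow_coeff0 :: "(nat \<Rightarrow> complex) \<Rightarrow> complex \<Rightarrow> complex \<Rightarrow> complex" where
  "kow_coeff0 a s x = - (4 * ((a 2 + s) * a 4 - (a 3)\<^sup>2) + x\<^sup>2 * (a 0 * a 4 - (a 5 - 2 * s)\<^sup>2)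
       + 4 * x * ((a 5 - 2 * s) * a 3 - a 1 * a 4))"

lemma kowF_hom_quadratic_x:
  "kowF_hom a s 1 x1 1 X Y = kow_coeff2 a s x1 / 4 * X\<^sup>2 + kow_coeff1 a s x1 / 4 * X * Y + kow_coeff0 a s x1 / 4 * Y\<^sup>2"
proof -
  have "4 * kowF_hom a s 1 x1 1 X Y = kow_coeff2 a s x1 * X\<^sup>2 + kow_coeff1 a s x1 * X * Y + kow_coeff0 a s x1 * Y\<^sup>2"
    unfolding kowF_hom_eq_form kow_form_def kow_coeff2_def kow_coeff1_def kow_coeff0_def power_one mult_1 mult_1_right by algebra
  then show ?thesis by (simp add: field_simps)
qed

lemma kowF_quadratic_x:
  "kowF a s x1 x2 =
    kow_coeff2 a s x1 / 4 * x2\<^sup>2 + kow_coeff1 a s x1 / 4 * x2 + kow_coeff0 a s x1 / 4"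
  using kowF_hom_quadratic_x[of a s x1 x2 1] by (simp add: kowF_hom_finite)

text \<open>On the line of points \<open>v\<close> with \<open>x1\<close> fixed, the discriminant of the form \<open>adj(M)\<close> is a
  constant times \<open>det M\<close> times the value of \<open>M\<close> on this line, which is a tangent of the fixed conic.\<close>

lemma kow_coeff_discriminant:
  "(kow_coeff1 a s x / 4)\<^sup>2 - 4 * (kow_coeff2 a s x / 4) * (kow_coeff0 a s x / 4)
    = pencil_cubic a s * pencil_quartic a x"
proof -
  have "(kow_coeff1 a s x)\<^sup>2 - 4 * kow_coeff2 a s x * kow_coeff0 a s x
      = 16 * (pencil_cubic a s * pencil_quartic a x)"
    unfolding kow_coeff1_def kow_coeff2_def kow_coeff0_def pencil_quartic_def pencil_cubic_def
    by algebra
  then show ?thesis by (simp add: power2_eq_square field_simps)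
qed

lemma discriminant_kowF_x:
  "discriminant (\<lambda>x2. kowF a s x1 x2) = pencil_cubic a s * pencil_quartic a x1"
  using discriminant_quadratic[of "\<lambda>x2. kowF a s x1 x2", OF kowF_quadratic_x]
  by (simp only: kow_coeff_discriminant)

text \<open>The two discriminants only determine \<open>P(x1) P(x2)\<close> and \<open>J(s) P(x1)\<close>, so \<open>P\<close> and \<open>J\<close> can still
  change sign simultaneously.\<close>

lemma quartic_and_cubic_up_to_sign:
  fixes a :: "nat \<Rightarrow> complex" and P J :: "complex poly"
  assumes "\<And>x1 x2. discriminant (\<lambda>s. kowF a s x1 x2) = poly P x1 * poly P x2"
    and "\<And>s x1. discriminant (\<lambda>x2. kowF a s x1 x2) = poly J s * poly P x1"
    and "P \<noteq> 0"
  obtains \<epsilon> where "\<epsilon>\<^sup>2 = 1" "\<And>x. poly P x = \<epsilon> * pencil_quartic a x" "\<And>s. poly J s = \<epsilon> * pencil_cubic a s"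
proof -
  have P: "poly P x * poly P y = pencil_quartic a x * pencil_quartic a y" for x y
    using assms(1) discriminant_kowF_s by metis
  have J: "poly J s * poly P x = pencil_cubic a s * pencil_quartic a x" for s x
    using assms(2) discriminant_kowF_x by metis
  obtain z where z: "poly P z \<noteq> 0" using assms(3) poly_all_0_iff_0 by blast
  define \<epsilon> where "\<epsilon> = pencil_quartic a z / poly P z"
  have "\<epsilon>\<^sup>2 = 1" using P[of z z] z by (simp add: \<epsilon>_def power_divide) (simp add: power2_eq_square)
  moreover have "poly P x = \<epsilon> * pencil_quartic a x" for x using P[of x z] z by (simp add: \<epsilon>_def field_simps)
  moreover have "poly J s = \<epsilon> * pencil_cubic a s" for s using J[of s z] z by (simp add: \<epsilon>_def field_simps)
  ultimately show ?thesis by (rule that)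
qed

section \<open>Binary quadratic forms on the projective line\<close>

lemma root_pair_exists:
  assumes "\<And>X Y. q X Y = A * X\<^sup>2 + B * X * Y + C * Y\<^sup>2" "B\<^sup>2 - 4 * A * C \<noteq> 0"
  shows "\<exists>R. root_pair q R"
proof (cases "A = 0")
  case True
  then have B: "B \<noteq> 0" using assms(2) by simp
  have "q X Y = (- B) * (X * hden Infty - Y * hnum Infty) * (X * hden (Fin (- C / B)) - Y * hnum (Fin (- C / B)))" for X Y
    using B True by (simp add: assms(1) field_simps power2_eq_square)
  then show ?thesis using B unfolding root_pair_def by (metis neg_equal_0_iff_equal)
next
  case False
  define d where "d = csqrt (B\<^sup>2 - 4 * A * C)"
  have d: "d\<^sup>2 = B\<^sup>2 - 4 * A * C" by (simp add: d_def)
  define u where "u = (- B + d) / (2 * A)"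
  define v where "v = (- B - d) / (2 * A)"
  have uv: "A * (u + v) = - B" using False by (simp add: u_def v_def field_simps)
  have "4 * A * (A * (u * v)) = B\<^sup>2 - d\<^sup>2" using False by (simp add: u_def v_def field_simps power2_eq_square)
  also have "\<dots> = 4 * A * C" using d by simp
  finally have uv': "A * (u * v) = C" using False by simp
  have "q X Y = A * (X * hden (Fin u) - Y * hnum (Fin u)) * (X * hden (Fin v) - Y * hnum (Fin v))" for X Y
    unfolding assms(1) hden.simps hnum.simps uv'[symmetric] using uv by algebra
  then show ?thesis using False unfolding root_pair_def by metis
qed

lemma root_pair_mem:
  assumes "root_pair q R"
  shows "Fin x \<in># R \<longleftrightarrow> q x 1 = 0"
proof -
  obtain p p' k where R: "R = {#p, p'#}" "k \<noteq> 0"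
     and q: "\<And>X Y. q X Y = k * (X * hden p - Y * hnum p) * (X * hden p' - Y * hnum p')"
    using assms(1) unfolding root_pair_def by blast
  have "x * hden p - 1 * hnum p = 0 \<longleftrightarrow> Fin x = p" for p by (cases p) auto
  then show ?thesis using R by (auto simp: q)
qed

text \<open>Turns the case distinctions in \<open>moebius\<close> into one linear map of homogeneous coordinates, up to a
  nonzero factor.\<close>

lemma moebius_hom:
  assumes "A * D - B * C \<noteq> 0"
  shows "\<exists>e. e \<noteq> 0 \<and> hnum (moebius A B C D p) = e * (A * hnum p + B * hden p) \<and>
        hden (moebius A B C D p) = e * (C * hnum p + D * hden p)"
proof (cases p)
  case (Fin z)
  show ?thesis
  proof (cases "C * z + D = 0")
    case True
    have "(A * z + B) * C = - (A * D - B * C)" "(A * z + B) * D = z * (A * D - B * C)"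
      using True by algebra+
    then have "A * z + B \<noteq> 0" using assms by auto
    then show ?thesis using Fin True by (intro exI[of _ "1 / (A * z + B)"]) auto
  next
    case False
    then show ?thesis using Fin by (intro exI[of _ "1 / (C * z + D)"]) auto
  qed
next
  case Infty
  show ?thesis
  proof (cases "C = 0")
    case True
    then show ?thesis using Infty assms by (intro exI[of _ "1 / A"]) auto
  next
    case False
    then show ?thesis using Infty by (intro exI[of _ "1 / C"]) auto
  qed
qed

lemma affine_map_moebius: "affine_map \<alpha> \<beta> = moebius \<alpha> \<beta> 0 1"
proof
  show "affine_map \<alpha> \<beta> p = moebius \<alpha> \<beta> 0 1 p" for p by (cases p) auto
qed

text \<open>The factors \<open>X * hden p - Y * hnum p\<close> are values of the determinant pairing, which a linear map of
  both arguments multiplies by \<open>A * D - B * C\<close>.\<close>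

lemma root_pair_moebius:
  assumes "root_pair q R" "A * D - B * C \<noteq> 0" "c \<noteq> 0"
    and "\<And>X Y. q' (A * X + B * Y) (C * X + D * Y) = c * q X Y"
  shows "root_pair q' (image_mset (moebius A B C D) R)"
proof -
  obtain p p' k where R: "R = {#p, p'#}" "k \<noteq> 0"
     and q: "\<And>X Y. q X Y = k * (X * hden p - Y * hnum p) * (X * hden p' - Y * hnum p')"
    using assms(1) unfolding root_pair_def by blast
  define \<Delta> where "\<Delta> = A * D - B * C"
  obtain e where e: "e \<noteq> 0" "hnum (moebius A B C D p) = e * (A * hnum p + B * hden p)"
        "hden (moebius A B C D p) = e * (C * hnum p + D * hden p)" using moebius_hom[OF assms(2)] by metis
  obtain e' where e': "e' \<noteq> 0" "hnum (moebius A B C D p') = e' * (A * hnum p' + B * hden p')"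
        "hden (moebius A B C D p') = e' * (C * hnum p' + D * hden p')" using moebius_hom[OF assms(2)] by metis
  have D: "\<Delta> \<noteq> 0" using assms(2) by (simp add: \<Delta>_def)
  have "q' X Y = (c * k / (e * e' * \<Delta>\<^sup>2)) * (X * hden (moebius A B C D p) - Y * hnum (moebius A B C D p))
        * (X * hden (moebius A B C D p') - Y * hnum (moebius A B C D p'))" for X Y
  proof -
    define x y where "x = (D * X - B * Y) / \<Delta>" and "y = (A * Y - C * X) / \<Delta>"
    have X: "X = A * x + B * y" and Y: "Y = C * x + D * y"
      using D unfolding x_def y_def by (simp_all add: field_simps) (simp_all add: \<Delta>_def algebra_simps)
    have l: "X * hden (moebius A B C D p) - Y * hnum (moebius A B C D p) = e * \<Delta> * (x * hden p - y * hnum p)"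
      unfolding e X Y \<Delta>_def by algebra
    have l': "X * hden (moebius A B C D p') - Y * hnum (moebius A B C D p') = e' * \<Delta> * (x * hden p' - y * hnum p')"
      unfolding e' X Y \<Delta>_def by algebra
    show ?thesis unfolding l l' using e(1) e'(1) D
      by (simp add: X Y assms(4) q power2_eq_square)
  qed
  moreover have "c * k / (e * e' * \<Delta>\<^sup>2) \<noteq> 0" using e(1) e'(1) D R assms by simp
  moreover have "image_mset (moebius A B C D) R = {#moebius A B C D p, moebius A B C D p'#}"
    by (simp add: R)
  ultimately show ?thesis unfolding root_pair_def by blast
qed

section \<open>The two-valued group law as a symmetric correspondence\<close>

text \<open>The homogenization, of degree 2 in each pair of variables, of
  \<open>(x1 x2 + x1 s + x2 s + g2/4)\<^sup>2 - (x1 + x2 + s) (4 x1 x2 s - g3)\<close>. Its vanishing is the condition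
  that points over \<open>x1\<close>, \<open>x2\<close>, \<open>s\<close> with suitable ordinates are collinear: on a line \<open>t = l m + n\<close> the
  abscissas are the roots of \<open>4 m\<^sup>3 - l\<^sup>2 m\<^sup>2 - (2 l n + g2) m - (n\<^sup>2 + g3)\<close>, and eliminating \<open>l\<close> and
  \<open>n\<close> from Vieta's formulas by \<open>(2 l n)\<^sup>2 = 4 l\<^sup>2 n\<^sup>2\<close> gives this equation.\<close>

definition addition_form :: "complex \<Rightarrow> complex \<Rightarrow> complex \<Rightarrow> complex \<Rightarrow>
    complex \<Rightarrow> complex \<Rightarrow> complex \<Rightarrow> complex \<Rightarrow> complex" where
  "addition_form g2 g3 s t x1 y1 x2 y2 =
    (x1 * x2 * t + x1 * y2 * s + x2 * y1 * s + g2 / 4 * (y1 * y2 * t))\<^sup>2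
    - (x1 * y2 * t + x2 * y1 * t + s * y1 * y2) * (4 * (x1 * x2 * s) - g3 * (y1 * y2 * t))"

lemma addition_form_symmetric: 
  "addition_form g2 g3 s t x1 y1 x2 y2 = addition_form g2 g3 x2 y2 s t x1 y1"
  by (simp add: addition_form_def algebra_simps)

text \<open>Converts the discriminant condition on \<open>g2\<close>, \<open>g3\<close> into a statement about roots: a cubic without
  quadratic term and with a double root \<open>e\<close> has the third root \<open>- 2 e\<close>.\<close>

lemma canonical_cubic_double_root:
  assumes "g2 ^ 3 = 27 * g3\<^sup>2"
  obtains e where "\<And>m. canonical_cubic g2 g3 m = 4 * (m - e)\<^sup>2 * (m + 2 * e)"
proof (cases "g2 = 0")
  case True
  then have "g3 = 0" using assms by simp
  with True show ?thesis by (intro that[of 0]) (simp add: canonical_cubic_def power2_eq_square power3_eq_cube)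
next
  case False
  define e where "e = - 3 * g3 / (2 * g2)"
  have e: "2 * g2 * e = - 3 * g3" using False by (simp add: e_def)
  have "g2\<^sup>2 * g2 = g2\<^sup>2 * (12 * e\<^sup>2)" using e assms by algebra
  then have g2: "g2 = 12 * e\<^sup>2" using False by simp
  have g3: "g3 = - 8 * e ^ 3" using e unfolding g2 by algebra
  show ?thesis
    by (rule that[of e], unfold canonical_cubic_def g2 g3, algebra)
qed

text \<open>The forms on both sides are compared directly. The generic case is the chord construction; for equal
  abscissas one of the two classes is the point at infinity, and the form has lower degree in \<open>S\<close>. The
  discriminant condition is what keeps the form nonzero at a point of order 2.\<close>

lemma coset_op_root_pair:
  assumes "g2 ^ 3 \<noteq> 27 * g3\<^sup>2"
  shows "root_pair (\<lambda>S T. addition_form g2 g3 S T (hnum x) (hden x) (hnum y) (hden y)) (coset_op g2 g3 x y)"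
proof -
  have *: "\<exists>k. k \<noteq> 0 \<and> (\<forall>S T. addition_form g2 g3 S T (hnum (eclass A)) (hden (eclass A)) (hnum (eclass B)) (hden (eclass B))
     = k * (S * hden (eclass (eadd g2 A B)) - T * hnum (eclass (eadd g2 A B)))
         * (S * hden (eclass (eadd g2 A (eneg B))) - T * hnum (eclass (eadd g2 A (eneg B)))))" (is "\<exists>k. ?Q k")
    if "A \<in> ecurve g2 g3" "B \<in> ecurve g2 g3" for A B
  proof (cases A)
    case A: None
    show ?thesis
    proof (rule exI[of _ 1], cases B)
      case None
      with A show "?Q 1" by (simp add: addition_form_def power2_eq_square)
    next
      case (Some b)
      with A show "?Q 1" by (cases b) (simp add: addition_form_def power2_eq_square algebra_simps)
    qed
  next
    case A: (Some a)
    obtain m1 t1 where a: "a = (m1, t1)" by (cases a)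
    have t1: "t1\<^sup>2 = 4 * m1 ^ 3 - g2 * m1 - g3" using that A a by (simp add: ecurve_def canonical_cubic_def)
    show ?thesis
    proof (cases B)
      case None
      with A a have "?Q 1" by (simp add: addition_form_def power2_eq_square algebra_simps)
      then show ?thesis by blast
    next
      case B: (Some b)
      obtain m2 t2 where b: "b = (m2, t2)" by (cases b)
      have t2: "t2\<^sup>2 = 4 * m2 ^ 3 - g2 * m2 - g3" using that B b by (simp add: ecurve_def canonical_cubic_def)
      show ?thesis
      proof (cases "m1 = m2")
        case False
        \<comment> \<open>With half slopes \<open>u\<close>, \<open>v\<close> of the two chords as unknowns, the curve equations become
          polynomial relations without denominators.\<close>
        define d u v where "d = m1 - m2" and "u = (t1 - t2) / (2 * d)" and "v = (t1 + t2) / (2 * d)"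
        have d: "d \<noteq> 0" using False by (simp add: d_def)
        have t: "t1 = d * (u + v)" "t2 = d * (v - u)" 
          using d by (simp_all add: u_def v_def field_simps)
        have "d * (4 * d * u * v) = d * (4 * (m1\<^sup>2 + m1 * m2 + m2\<^sup>2) - g2)"
          using t1 t2 unfolding t d_def by algebra
        then have uv: "4 * d * u * v = 4 * (m1\<^sup>2 + m1 * m2 + m2\<^sup>2) - g2" using d by simp
        have e: "eclass (eadd g2 A B) = Fin (- m1 - m2 + u\<^sup>2)"
          "eclass (eadd g2 A (eneg B)) = Fin (- m1 - m2 + v\<^sup>2)"
          using False by (simp_all add: A B a b u_def v_def d_def Let_def mult.commute)
        have "addition_form g2 g3 S T m1 1 m2 1 = d\<^sup>2 * (S - T * (- m1 - m2 + u\<^sup>2)) * (S - T * (- m1 - m2 + v\<^sup>2))" for S T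
        proof -
          have "16 * addition_form g2 g3 S T m1 1 m2 1 = (4 * m1 * m2 * T + 4 * m1 * S + 4 * m2 * S + g2 * T)\<^sup>2
             - 16 * (m1 * T + m2 * T + S) * (4 * (m1 * m2 * S) - g3 * T)"
            by (simp add: addition_form_def power2_eq_square algebra_simps)
          also have "\<dots> = 16 * (d\<^sup>2 * (S - T * (- m1 - m2 + u\<^sup>2)) * (S - T * (- m1 - m2 + v\<^sup>2)))"
            using t1 t2 uv unfolding t d_def by algebra
          finally show ?thesis by simp
        qed
        then have "?Q (d\<^sup>2)" using d unfolding e by (simp add: A B a b)
        then show ?thesis by blast
      next
        case m: True
        show ?thesis
        proof (cases "t1 = 0")
          case True
          with t1 t2 m have "t2 = 0" by simp
          define k where "k = (12 * m1\<^sup>2 - g2) / 4"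
          have k: "4 * k = 12 * m1\<^sup>2 - g2" by (simp add: k_def)
          have "k \<noteq> 0"
          proof
            assume "k = 0"
            then have "g2 = 12 * m1\<^sup>2" by (simp add: k_def)
            moreover from this have "g3 = - 8 * m1 ^ 3" using t1 True by algebra
            ultimately have "g2 ^ 3 = 27 * g3\<^sup>2" by algebra
            with assms show False by simp
          qed
          moreover have "addition_form g2 g3 S T m1 1 m1 1 = k\<^sup>2 * T\<^sup>2" for S T
          proof -
            have "16 * addition_form g2 g3 S T m1 1 m1 1 = (4 * m1\<^sup>2 * T + 8 * m1 * S + g2 * T)\<^sup>2
             - 16 * (2 * m1 * T + S) * (4 * (m1\<^sup>2 * S) - g3 * T)"
            by (simp add: addition_form_def power2_eq_square algebra_simps)
            also have "\<dots> = (4 * k)\<^sup>2 * T\<^sup>2" using t1 True k by algebra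
            finally show ?thesis by (simp add: power_mult_distrib)
          qed
          ultimately have "?Q (k\<^sup>2)" using m True \<open>t2 = 0\<close> by (simp add: A B a b power2_eq_square)
          then show ?thesis by blast
        next
          case False
          define l where "l = (12 * m1\<^sup>2 - g2) / (2 * t1)"
          have l: "2 * t1 * l = 12 * m1\<^sup>2 - g2" using False by (simp add: l_def)
          have G: "addition_form g2 g3 S T m1 1 m1 1 = t1\<^sup>2 * (S - T * (- m1 - m1 + (l / 2)\<^sup>2)) * (- T)" for S T
          proof -
            have "16 * addition_form g2 g3 S T m1 1 m1 1 = (4 * m1\<^sup>2 * T + 8 * m1 * S + g2 * T)\<^sup>2
             - 16 * (2 * m1 * T + S) * (4 * (m1\<^sup>2 * S) - g3 * T)"
            by (simp add: addition_form_def power2_eq_square algebra_simps)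
            also have "\<dots> = (2 * t1 * l)\<^sup>2 * T\<^sup>2 - 16 * t1\<^sup>2 * T * (S + 2 * m1 * T)"
              unfolding l t1 by algebra
            also have "\<dots> = 16 * (t1\<^sup>2 * (S - T * (- m1 - m1 + (l / 2)\<^sup>2)) * (- T))"
              by (simp add: power2_eq_square algebra_simps)
            finally show ?thesis
              by (rule mult_left_cancel[THEN iffD1, rotated]) simp
          qed
          from m t1 t2 have "t2\<^sup>2 = t1\<^sup>2" by simp
          then consider "t2 = t1" | "t2 = - t1" by (auto simp: power2_eq_iff)
          then show ?thesis
          proof cases
            case 1
            then have "?Q (t1\<^sup>2)" using False unfolding A B a b m[symmetric]
              by (simp add: G Let_def flip: l_def)
            then show ?thesis by blast
          next
            case 2
            then have "?Q (t1\<^sup>2)" using False unfolding A B a b m[symmetric]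
              by (simp add: G Let_def flip: l_def)
            then show ?thesis by blast
          qed
        qed
      qed
    qed
  qed
  from *[OF erep(1) erep(1), of x y] show ?thesis
    unfolding root_pair_def coset_op_def Let_def erep(2) by blast
qed

section \<open>Normal form of F\<close>

text \<open>The parameters of the pencil after the substitution \<open>x = c + 1/y\<close>: the translation by \<open>c\<close> acts on
  \<open>M\<close> by a unipotent congruence, and the inversion reverses the order of rows and columns.\<close>

definition recentred :: "(nat \<Rightarrow> complex) \<Rightarrow> complex \<Rightarrow> nat \<Rightarrow> complex" where
  "recentred a c = (\<lambda>_. 0)
    (0 := a 4 - 4 * c * a 3 + c\<^sup>2 * (4 * a 2 + 2 * a 5) - 4 * c ^ 3 * a 1 + c ^ 4 * a 0,
     1 := a 3 - 2 * c * a 2 - c * a 5 + 3 * c\<^sup>2 * a 1 - c ^ 3 * a 0,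
     2 := a 2 - 2 * c * a 1 + c\<^sup>2 * a 0,
     3 := a 1 - c * a 0,
     4 := a 0,
     5 := a 5 - 2 * c * a 1 + c\<^sup>2 * a 0)"

lemma recentred_simps:
  "recentred a c 0 = a 4 - 4 * c * a 3 + c\<^sup>2 * (4 * a 2 + 2 * a 5) - 4 * c ^ 3 * a 1 + c ^ 4 * a 0"
  "recentred a c 1 = a 3 - 2 * c * a 2 - c * a 5 + 3 * c\<^sup>2 * a 1 - c ^ 3 * a 0"
  "recentred a c 2 = a 2 - 2 * c * a 1 + c\<^sup>2 * a 0"
  "recentred a c 3 = a 1 - c * a 0"
  "recentred a c 4 = a 0"
  "recentred a c 5 = a 5 - 2 * c * a 1 + c\<^sup>2 * a 0"
  by (simp_all add: recentred_def)

lemma kowF_hom_recentred: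
  "kowF_hom a s t (c * x1 + y1) x1 (c * x2 + y2) x2 = kowF_hom (recentred a c) s t x1 y1 x2 y2"
proof -
  have "kow_form a s t (x1 * x2) ((c * x1 + y1) * x2 + (c * x2 + y2) * x1) ((c * x1 + y1) * (c * x2 + y2))
     = kow_form (recentred a c) s t (y1 * y2) (x1 * y2 + x2 * y1) (x1 * x2)"
    unfolding kow_form_def recentred_simps by algebra
  then show ?thesis by (simp flip: kowF_hom_eq_form)
qed

lemma pencil_quartic_recentred:
  assumes "x \<noteq> c"
  shows "pencil_quartic (recentred a c) (1 / (x - c)) * (x - c) ^ 4 = pencil_quartic a x"
proof -
  have "(x - c) * (1 / (x - c)) = 1" using assms by simp
  then have "pencil_quartic (recentred a c) (1 / (x - c)) * (x - c) ^ 4 =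
    recentred a c 0 - 4 * recentred a c 1 * (x - c) + (4 * recentred a c 2 + 2 * recentred a c 5) * (x - c)\<^sup>2
     - 4 * recentred a c 3 * (x - c) ^ 3 + recentred a c 4 * (x - c) ^ 4"
    unfolding pencil_quartic_def by algebra
  also have "\<dots> = pencil_quartic a x"
    unfolding recentred_simps pencil_quartic_def by algebra
  finally show ?thesis .
qed

lemma recentred_0: "recentred a c 0 = pencil_quartic a c"
  unfolding recentred_simps pencil_quartic_def by algebra

lemma pencil_cubic_recentred: "pencil_cubic (recentred a c) s = pencil_cubic a s"
  unfolding pencil_cubic_def recentred_simps by algebra

text \<open>These are the invariants of the normalized cubic for a pencil \<open>b\<close> with \<open>b 0 = 0\<close>. Here \<open>N\<close> stands for
  \<open>(b 5 + 2 * b 2) / 6\<close>, the shift that removes the quadratic term.\<close>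

definition normal_g2 :: "(nat \<Rightarrow> complex) \<Rightarrow> complex \<Rightarrow> complex" where
  "normal_g2 b N = 4 * (3 * N\<^sup>2 - b 1 * b 3)"

definition normal_g3 :: "complex \<Rightarrow> (nat \<Rightarrow> complex) \<Rightarrow> complex \<Rightarrow> complex" where
  "normal_g3 \<alpha> b N = - \<alpha> * ((b 1)\<^sup>2 * b 4 - 4 * N * b 1 * b 3 + 8 * N ^ 3)"

text \<open>For \<open>b 0 = 0\<close> the quartic becomes a cubic in \<open>y\<close>, to be brought to the form \<open>4 \<xi>\<^sup>3 - g2 \<xi> - g3\<close> by
  \<open>y = (N - \<alpha> \<xi>) / b 1\<close>. The coefficient of \<open>x2\<^sup>2\<close> in \<open>F\<close> is then
  \<open>(b 5 / 2 - s - b 1 y)\<^sup>2\<close>, while the one in the addition form is \<open>(\<xi> - w)\<^sup>2\<close>; this forces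
  \<open>s = \<alpha> w + 2 N - b 2\<close>. The sign \<open>\<alpha>\<close> makes room for the two possible signs of \<open>J\<close>.\<close>

lemma kowF_hom_canonical:
  assumes "b 0 = 0" "b 5 = 6 * N - 2 * b 2" "\<alpha>\<^sup>2 = 1"
  shows "kowF_hom b (\<alpha> * w + (2 * N - b 2) * t) t
      (N * y1 - \<alpha> * x1) (b 1 * y1) (N * y2 - \<alpha> * x2) (b 1 * y2)
    = (b 1)\<^sup>2 * addition_form (normal_g2 b N) (normal_g3 \<alpha> b N) w t x1 y1 x2 y2"
proof -
  define G3 where "G3 = (b 1)\<^sup>2 * b 4 - 4 * N * b 1 * b 3 + 8 * N ^ 3"
  have "kow_form b (\<alpha> * w + (2 * N - b 2) * t) t (b 1 * y1 * (b 1 * y2))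
      ((N * y1 - \<alpha> * x1) * (b 1 * y2) + (N * y2 - \<alpha> * x2) * (b 1 * y1))
      ((N * y1 - \<alpha> * x1) * (N * y2 - \<alpha> * x2))
    = 4 * (b 1)\<^sup>2 *
      ((x1 * x2 * t + x1 * y2 * w + x2 * y1 * w + (3 * N\<^sup>2 - b 1 * b 3) * (y1 * y2 * t))\<^sup>2
       - (x1 * y2 * t + x2 * y1 * t + w * y1 * y2)
         * (4 * (x1 * x2 * w) + \<alpha> * G3 * (y1 * y2 * t)))"
    unfolding kow_form_def assms(1,2) G3_def using assms(3) by algebra
  also have "\<dots> = 4 * ((b 1)\<^sup>2 *
      addition_form (normal_g2 b N) (normal_g3 \<alpha> b N) w t x1 y1 x2 y2)"
    unfolding addition_form_def normal_g2_def normal_g3_def G3_def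
      nonzero_mult_div_cancel_left[OF zero_neq_numeral[symmetric]] by algebra
  finally show ?thesis by (simp flip: kowF_hom_eq_form)
qed

text \<open>The same two affine substitutions bring the cubic \<open>J\<close> and the recentred quartic to one and the same
  normal form, which identifies the curves \<open>\<Gamma>\<^sub>1\<close> and \<open>\<Gamma>\<^sub>2\<close>.\<close>

lemma pencil_cubic_canonical:
  assumes "b 0 = 0" "b 5 = 6 * N - 2 * b 2" "\<alpha>\<^sup>2 = 1"
  shows "\<alpha> * pencil_cubic b (\<alpha> * m + (2 * N - b 2)) =
    canonical_cubic (normal_g2 b N) (normal_g3 \<alpha> b N) m"
  unfolding pencil_cubic_def canonical_cubic_def normal_g2_def normal_g3_def assms(1,2) using assms(3) by algebra

lemma pencil_quartic_canonical:
  assumes "b 0 = 0" "b 5 = 6 * N - 2 * b 2" "\<alpha>\<^sup>2 = 1" "b 1 * y = N - \<alpha> * m"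
  shows "\<alpha> * (b 1)\<^sup>2 * pencil_quartic b y =
    canonical_cubic (normal_g2 b N) (normal_g3 \<alpha> b N) m"
  unfolding pencil_quartic_def canonical_cubic_def normal_g2_def normal_g3_def assms(1,2) using assms(3,4) by algebra

text \<open>The counting argument behind both nondegeneracy conditions: the three zeros of the quartic other than \<open>c\<close>
  stay distinct under an injective change of coordinate.\<close>

lemma card_ge_3_if_separates_roots:
  assumes "card {x. pencil_quartic a x = 0} = 4" "pencil_quartic a c = 0"
    and "inj_on f (- {c})" "f ` {x. pencil_quartic a x = 0 \<and> x \<noteq> c} \<subseteq> S" "finite S"
  shows "card S \<ge> 3"
proof -
  have "finite {x. pencil_quartic a x = 0}" using assms(1) by (metis card.infinite zero_neq_numeral)
  moreover have "{x. pencil_quartic a x = 0 \<and> x \<noteq> c} = {x. pencil_quartic a x = 0} - {c}" by auto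
  ultimately have "card {x. pencil_quartic a x = 0 \<and> x \<noteq> c} = 3" using assms(1,2) by simp
  moreover have "inj_on f {x. pencil_quartic a x = 0 \<and> x \<noteq> c}" using assms(3) by (rule inj_on_subset) auto
  ultimately show ?thesis using card_inj_on_le assms(4,5) by metis
qed

text \<open>If this coefficient vanished, the three remaining zeros of the quartic would give three roots of a
  nonzero polynomial of degree at most 2.\<close>

lemma recentred_1_nonzero:
  assumes "card {x. pencil_quartic a x = 0} = 4" "pencil_quartic a c = 0"
  shows "recentred a c 1 \<noteq> 0"
proof
  define b where "b = recentred a c"
  assume b1: "recentred a c 1 = 0"
  have b0: "recentred a c 0 = 0" using assms(2) by (simp add: recentred_0)
  define q where "q = [:b 4, - 4 * b 3, 4 * b 2 + 2 * b 5:]"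
  have q: "poly q y = pencil_quartic b y" for y
    using b0 b1 by (simp add: q_def pencil_quartic_def b_def power2_eq_square algebra_simps)
  have root: "poly q (1 / (x - c)) = 0 \<longleftrightarrow> pencil_quartic a x = 0" if "x \<noteq> c" for x
    using pencil_quartic_recentred[OF that, of a] that by (auto simp: q b_def)
  have "q \<noteq> 0"
  proof
    assume "q = 0"
    then have "pencil_quartic a x = 0" for x using root[of x] assms(2) by (cases "x = c") auto
    then show False using assms(1) by (simp add: infinite_UNIV_char_0)
  qed
  then have "finite {y. poly q y = 0}" "card {y. poly q y = 0} \<le> degree q"
    by (rule poly_roots_finite, rule card_poly_roots_bound)
  moreover have "degree q \<le> 2" by (simp add: q_def)
  moreover have "card {y. poly q y = 0} \<ge> 3"
    by (rule card_ge_3_if_separates_roots[OF assms, of "\<lambda>x. 1 / (x - c)"])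
       (auto simp: inj_on_def root \<open>finite _\<close> )
  ultimately show False by simp
qed

text \<open>The map \<open>\<psi>\<close> is the composite of \<open>\<xi> \<mapsto> y = (N - \<alpha> \<xi>) / b 1\<close> and \<open>y \<mapsto> x = c + 1/y\<close>; it sends the unit
  to the zero \<open>c\<close> of the quartic. The curve is nonsingular because a double root of its cubic would leave
  only two places for the three remaining zeros.\<close>

lemma kowalevski_coset_group:
  assumes "card {x. pencil_quartic a x = 0} = 4" and "\<alpha>\<^sup>2 = 1"
  shows "\<exists>\<psi> \<beta> g2 g3. fractional_linear \<psi> \<and> g2 ^ 3 \<noteq> 27 * g3\<^sup>2 \<and>
        (\<forall>m. \<alpha> * pencil_cubic a (\<alpha> * m + \<beta>) = canonical_cubic g2 g3 m) \<and>
        (\<forall>\<xi>1 \<xi>2. kow_roots a (\<psi> \<xi>1) (\<psi> \<xi>2)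
           (image_mset (affine_map \<alpha> \<beta>) (coset_op g2 g3 \<xi>1 \<xi>2))) \<and>
        (\<forall>\<omega> \<xi>. coset_action a (affine_map \<alpha> \<beta> \<omega>) (\<psi> \<xi>)
           (image_mset \<psi> (coset_op g2 g3 \<omega> \<xi>)))"
proof -
  have \<alpha>: "\<alpha> \<noteq> 0" using assms(2) by auto
  have "{x. pencil_quartic a x = 0} \<noteq> {}" using assms(1) by (metis card.empty zero_neq_numeral)
  then obtain c where c: "pencil_quartic a c = 0" by blast
  define b where "b = recentred a c"
  have b0: "b 0 = 0" using c by (simp add: b_def recentred_0)
  have b1: "b 1 \<noteq> 0" unfolding b_def by (rule recentred_1_nonzero[OF assms(1) c])
  define N where "N = (b 5 + 2 * b 2) / 6"
  have b5: "b 5 = 6 * N - 2 * b 2" by (simp add: N_def field_simps)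
  define \<beta> where "\<beta> = 2 * N - b 2"
  define g2 where "g2 = normal_g2 b N"
  define g3 where "g3 = normal_g3 \<alpha> b N"
  have disc: "g2 ^ 3 \<noteq> 27 * g3\<^sup>2"
  proof
    assume "g2 ^ 3 = 27 * g3\<^sup>2"
    then obtain e where e: "\<And>m. canonical_cubic g2 g3 m = 4 * (m - e)\<^sup>2 * (m + 2 * e)"
      using canonical_cubic_double_root by metis
    \<comment> \<open>the coordinate \<open>\<xi>\<close> of a zero \<open>x\<close> of the quartic\<close>
    define f where "f x = \<alpha> * (N - b 1 * (1 / (x - c)))" for x
    have "inj_on f (- {c})" using \<alpha> b1 by (auto simp: f_def inj_on_def)
    moreover have "f x = e \<or> f x = - 2 * e" if "pencil_quartic a x = 0" "x \<noteq> c" for x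
    proof -
      have "pencil_quartic b (1 / (x - c)) = 0" using pencil_quartic_recentred[OF that(2), of a] that by (simp add: b_def)
      moreover have "b 1 * (1 / (x - c)) = N - \<alpha> * f x"
        using assms(2) unfolding f_def by algebra
      ultimately have "canonical_cubic g2 g3 (f x) = 0"
        using pencil_quartic_canonical[OF b0 b5 assms(2)] unfolding g2_def g3_def by (metis mult_zero_right)
      then show ?thesis unfolding e by (auto simp: eq_neg_iff_add_eq_0)
    qed
    ultimately have "card {e, - 2 * e} \<ge> 3"
      by (intro card_ge_3_if_separates_roots[OF assms(1) c, of f]) auto
    moreover have "card {e, - 2 * e} \<le> 2" by (simp add: card_insert_if)
    ultimately show False by simp
  qed
  \<comment> \<open>\<open>x = c + 1/y\<close> with \<open>y = (N - \<alpha> \<xi>) / b 1\<close> is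
    \<open>(c (N - \<alpha> \<xi>) + b 1) / (N - \<alpha> \<xi>)\<close>\<close>
  define A B C D where "A = - \<alpha> * c" and "B = c * N + b 1" and "C = - \<alpha>" and "D = N"
  define \<psi> where "\<psi> = moebius A B C D"
  have det: "A * D - B * C \<noteq> 0"
  proof -
    have "A * D - B * C = \<alpha> * b 1" unfolding A_def B_def C_def D_def by algebra
    with \<alpha> b1 show ?thesis by simp
  qed
  have norm: "kowF_hom a (\<alpha> * w + \<beta> * t) t (A * x1 + B * y1) (C * x1 + D * y1) (A * x2 + B * y2) (C * x2 + D * y2)
    = (b 1)\<^sup>2 * addition_form g2 g3 w t x1 y1 x2 y2" for w t x1 y1 x2 y2
  proof -
    have x: "A * x + B * y = c * (N * y - \<alpha> * x) + b 1 * y" "C * x + D * y = N * y - \<alpha> * x" for x y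
      unfolding A_def B_def C_def D_def by algebra+
    show ?thesis unfolding x kowF_hom_recentred
      using kowF_hom_canonical[OF b0 b5 assms(2)] by (simp add: g2_def g3_def \<beta>_def b_def)
  qed
  have "kow_roots a (\<psi> \<xi>1) (\<psi> \<xi>2) (image_mset (affine_map \<alpha> \<beta>) (coset_op g2 g3 \<xi>1 \<xi>2))" for \<xi>1 \<xi>2
  proof -
    obtain e1 where e1: "e1 \<noteq> 0" "hnum (\<psi> \<xi>1) = e1 * (A * hnum \<xi>1 + B * hden \<xi>1)"
        "hden (\<psi> \<xi>1) = e1 * (C * hnum \<xi>1 + D * hden \<xi>1)" 
      using moebius_hom[OF det] unfolding \<psi>_def by metis
    obtain e2 where e2: "e2 \<noteq> 0" "hnum (\<psi> \<xi>2) = e2 * (A * hnum \<xi>2 + B * hden \<xi>2)"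
        "hden (\<psi> \<xi>2) = e2 * (C * hnum \<xi>2 + D * hden \<xi>2)" 
      using moebius_hom[OF det] unfolding \<psi>_def by metis
    show ?thesis
      unfolding kow_roots_def affine_map_moebius
    proof (rule root_pair_moebius[OF coset_op_root_pair[OF disc]])
      show "\<alpha> * 1 - \<beta> * 0 \<noteq> 0" "e1\<^sup>2 * e2\<^sup>2 * (b 1)\<^sup>2 \<noteq> 0" using \<alpha> e1 e2 b1 by simp_all
      show "kowF_hom a (\<alpha> * X + \<beta> * Y) (0 * X + 1 * Y) (hnum (\<psi> \<xi>1)) (hden (\<psi> \<xi>1)) (hnum (\<psi> \<xi>2)) (hden (\<psi> \<xi>2))
        = e1\<^sup>2 * e2\<^sup>2 * (b 1)\<^sup>2 * addition_form g2 g3 X Y (hnum \<xi>1) (hden \<xi>1) (hnum \<xi>2) (hden \<xi>2)" for X Y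
        unfolding e1 e2 kowF_hom_scale mult_zero_left mult_1 add_0 norm by (simp only: mult.assoc)
    qed
  qed
  moreover have "coset_action a (affine_map \<alpha> \<beta> \<omega>) (\<psi> \<xi>) (image_mset \<psi> (coset_op g2 g3 \<omega> \<xi>))" for \<omega> \<xi>
  proof -
    obtain e1 where e1: "e1 \<noteq> 0" "hnum (\<psi> \<xi>) = e1 * (A * hnum \<xi> + B * hden \<xi>)"
        "hden (\<psi> \<xi>) = e1 * (C * hnum \<xi> + D * hden \<xi>)" 
      using moebius_hom[OF det] unfolding \<psi>_def by metis
    have "\<alpha> * 1 - \<beta> * 0 \<noteq> 0" using \<alpha> by simp
    then obtain e2 where e2: "e2 \<noteq> 0" "hnum (affine_map \<alpha> \<beta> \<omega>) = e2 * (\<alpha> * hnum \<omega> + \<beta> * hden \<omega>)"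
        "hden (affine_map \<alpha> \<beta> \<omega>) = e2 * (0 * hnum \<omega> + 1 * hden \<omega>)" 
      using moebius_hom unfolding affine_map_moebius by metis
    show ?thesis
      unfolding coset_action_def
      unfolding \<psi>_def
    proof (rule root_pair_moebius[OF coset_op_root_pair[OF disc] det], fold \<psi>_def)
      show "e1\<^sup>2 * e2\<^sup>2 * (b 1)\<^sup>2 \<noteq> 0" using e1 e2 b1 by simp_all
      show "kowF_hom a (hnum (affine_map \<alpha> \<beta> \<omega>)) (hden (affine_map \<alpha> \<beta> \<omega>)) (hnum (\<psi> \<xi>)) (hden (\<psi> \<xi>)) (A * X + B * Y) (C * X + D * Y)
        = e1\<^sup>2 * e2\<^sup>2 * (b 1)\<^sup>2 * addition_form g2 g3 X Y (hnum \<omega>) (hden \<omega>) (hnum \<xi>) (hden \<xi>)" for X Y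
      proof -
        have "kowF_hom a (hnum (affine_map \<alpha> \<beta> \<omega>)) (hden (affine_map \<alpha> \<beta> \<omega>)) (hnum (\<psi> \<xi>)) (hden (\<psi> \<xi>)) (1 * (A * X + B * Y)) (1 * (C * X + D * Y))
        = e1\<^sup>2 * 1\<^sup>2 * (e2\<^sup>2 * ((b 1)\<^sup>2 * addition_form g2 g3 (hnum \<omega>) (hden \<omega>) (hnum \<xi>) (hden \<xi>) X Y))"
          unfolding e1 e2 kowF_hom_scale kowF_hom_scale_s 
          unfolding mult_zero_left mult_1 add_0 norm ..
        then show ?thesis using addition_form_symmetric[of g2 g3 "hnum \<omega>" "hden \<omega>" "hnum \<xi>" "hden \<xi>" X Y] by simp
      qed
    qed
  qed
  moreover have "\<alpha> * pencil_cubic a (\<alpha> * m + \<beta>) = canonical_cubic g2 g3 m" for m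
    using pencil_cubic_canonical[OF b0 b5 assms(2)] by (simp add: g2_def g3_def \<beta>_def b_def pencil_cubic_recentred)
  moreover have "fractional_linear \<psi>" unfolding fractional_linear_def \<psi>_def using det by blast
  ultimately show ?thesis using disc by blast
qed

section \<open>The differential of F on the surface F = 0\<close>

text \<open>The discriminant in \<open>x2\<close> is nonzero here, so \<open>F\<close> is a nonzero form in \<open>x2\<close> and the pair of roots
  exists.\<close>

lemma coset_action_graph:
  assumes "pencil_cubic a s \<noteq> 0" "pencil_quartic a x1 \<noteq> 0"
  shows "(\<exists>R. coset_action a (Fin s) (Fin x1) R \<and> Fin x2 \<in># R) \<longleftrightarrow> kowF a s x1 x2 = 0"
proof -
  have "\<exists>R. coset_action a (Fin s) (Fin x1) R"
    unfolding coset_action_def hnum.simps hden.simps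
    by (rule root_pair_exists[OF kowF_hom_quadratic_x])
       (simp only: kow_coeff_discriminant mult_eq_0_iff assms, simp)
  moreover have "Fin x2 \<in># R \<longleftrightarrow> kowF a s x1 x2 = 0" if "coset_action a (Fin s) (Fin x1) R" for R
    using root_pair_mem[OF that[unfolded coset_action_def]] by (simp add: kowF_hom_finite)
  ultimately show ?thesis by blast
qed

definition kow_ds where "kow_ds a s x1 x2 = 2 * (x1 - x2)\<^sup>2 * s + kow_linear a x1 x2"

text \<open>The partial derivative of \<open>F\<close> in \<open>x1\<close>. As \<open>F\<close> is symmetric in \<open>x1\<close> and \<open>x2\<close>, the one in \<open>x2\<close> is
  \<open>kow_dx a s x2 x1\<close>.\<close>

definition kow_dx where "kow_dx a s x1 x2 = (2 * kow_coeff2 a s x2 * x1 + kow_coeff1 a s x2) / 4"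

lemma kowF_has_derivative:
  "((\<lambda>(s, x1, x2). kowF a s x1 x2) has_derivative
     (\<lambda>(k, h1, h2). kow_ds a s x1 x2 * k + kow_dx a s x1 x2 * h1 + kow_dx a s x2 x1 * h2)) (at (s, x1, x2))"
proof -
  have eq: "(\<lambda>(s, x1, x2). kowF a s x1 x2) = (\<lambda>z. kow_form a (fst z) 1 1 (fst (snd z) + snd (snd z)) (fst (snd z) * snd (snd z)) / 4)"
    by (auto simp: fun_eq_iff simp flip: kowF_eq_form)
  have two: "(2::nat) - 1 = 1" by simp
  define D where "D = (\<lambda>(k, h1, h2). kow_ds a s x1 x2 * k + kow_dx a s x1 x2 * h1 + kow_dx a s x2 x1 * h2)"
  have 4: "4 * D (k, h1, h2) = 4 * kow_ds a s x1 x2 * k + (2 * kow_coeff2 a s x2 * x1 + kow_coeff1 a s x2) * h1 + (2 * kow_coeff2 a s x1 * x2 + kow_coeff1 a s x1) * h2" for k h1 h2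
    by (simp add: D_def kow_dx_def field_simps)
  have "((\<lambda>z. kow_form a (fst z) 1 1 (fst (snd z) + snd (snd z)) (fst (snd z) * snd (snd z))) has_derivative (\<lambda>h. 4 * D h)) (at (s, x1, x2))"
    unfolding kow_form_def power_one mult_1 mult_1_right
    by ((rule derivative_eq_intros refl)+, rule ext, clarify,
        simp only: 4 fst_conv snd_conv add_0 diff_0 diff_0_right of_nat_numeral two power_one_right,
        unfold kow_ds_def kow_linear_def kow_coeff2_def kow_coeff1_def, algebra)
  from has_derivative_mult_right[OF this, of "1 / 4"] show ?thesis
   unfolding eq D_def[symmetric] by simp
qed

text \<open>An instance of \<open>(2 A x + B)\<^sup>2 = B\<^sup>2 - 4 A C + 4 A (A x\<^sup>2 + B x + C)\<close>.\<close>

lemma kow_dx_sq: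
  "(kow_dx a s x1 x2)\<^sup>2 =
    pencil_cubic a s * pencil_quartic a x2 + kow_coeff2 a s x2 * kowF a s x1 x2"
  unfolding kow_coeff_discriminant[symmetric] kow_dx_def kowF_sym[of a s x1 x2]
    kowF_quadratic_x[of a s x2 x1]
  by (simp add: power2_eq_square field_simps)

text \<open>The squares of both sides agree on \<open>F = 0\<close> by the discriminant identities; the point is the sign.
  It decides which root in \<open>s\<close> goes with the sum of the forms \<open>dx / sqrt P\<close>, and which one with the
  difference.\<close>

lemma kow_dx_mult:
  assumes "kowF a s x1 x2 = 0"
  shows "kow_dx a s x1 x2 * kow_dx a s x2 x1 = - pencil_cubic a s * kow_ds a s x1 x2"
proof -
  have "kow_form a s 1 1 (x1 + x2) (x1 * x2) = 0" using assms kowF_eq_form by (metis mult_zero_right)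
  then have "(2 * kow_coeff2 a s x2 * x1 + kow_coeff1 a s x2) * (2 * kow_coeff2 a s x1 * x2 + kow_coeff1 a s x1) = - 16 * pencil_cubic a s * kow_ds a s x1 x2"
    unfolding kow_form_def power_one mult_1 mult_1_right kow_coeff2_def kow_coeff1_def pencil_cubic_def kow_ds_def kow_linear_def by algebra
  then show ?thesis by (simp add: kow_dx_def)
qed

section \<open>The Kowalevski change of variables\<close>

text \<open>The quadratic formula for \<open>F = 0\<close> in \<open>s\<close>, with the square root \<open>\<epsilon> r1(x1) r2(x2)\<close> of the discriminant.
  Changing the sign of \<open>\<epsilon>\<close>, or that of \<open>r2\<close>, gives the other root.\<close>

definition kow_root :: "(nat \<Rightarrow> complex) \<Rightarrow> complex \<Rightarrow> (complex \<Rightarrow> complex) \<Rightarrow> (complex \<Rightarrow> complex) \<Rightarrow> complex \<times> complex \<Rightarrow> complex" where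
  "kow_root a \<epsilon> r1 r2 = (\<lambda>(x1, x2). (- kow_linear a x1 x2 - \<epsilon> * r1 x1 * r2 x2) / (2 * (x1 - x2)\<^sup>2))"

lemma kow_ds_root:
  assumes "x1 \<noteq> x2"
  shows "kow_ds a (kow_root a \<epsilon> r1 r2 (x1, x2)) x1 x2 = - \<epsilon> * r1 x1 * r2 x2"
  using assms by (simp add: kow_root_def kow_ds_def)

lemma kowF_hom_factor:
  assumes "x1 \<noteq> x2" "\<epsilon>\<^sup>2 = 1" "(r1 x1)\<^sup>2 = \<epsilon> * pencil_quartic a x1" "(r2 x2)\<^sup>2 = \<epsilon> * pencil_quartic a x2"
  shows "kowF_hom a s t x1 1 x2 1 = (x1 - x2)\<^sup>2 * (s - t * kow_root a \<epsilon> r1 r2 (x1, x2))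
     * (s - t * kow_root a (- \<epsilon>) r1 r2 (x1, x2))"
proof -
  define A w v where "A = (x1 - x2)\<^sup>2" and "w = kow_root a \<epsilon> r1 r2 (x1, x2)"
    and "v = kow_root a (- \<epsilon>) r1 r2 (x1, x2)"
  have A: "A \<noteq> 0" using assms by (simp add: A_def)
  have w: "2 * A * w = - kow_linear a x1 x2 - \<epsilon> * r1 x1 * r2 x2"
     and v: "2 * A * v = - kow_linear a x1 x2 + \<epsilon> * r1 x1 * r2 x2"
    using A by (simp_all add: w_def v_def kow_root_def A_def)
  have F0: "4 * A * kowF a 0 x1 x2 = (kow_linear a x1 x2)\<^sup>2 - pencil_quartic a x1 * pencil_quartic a x2"
    unfolding A_def kow_linear_discriminant[symmetric] by algebra
  \<comment> \<open>Completing the square needs \<open>(r1 * r2)\<^sup>2\<close> to be the discriminant; the two signs \<open>\<epsilon>\<close> cancel in it.\<close>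
  have "4 * A * (A * s\<^sup>2 + kow_linear a x1 x2 * s * t + kowF a 0 x1 x2 * t\<^sup>2) = (2 * A * s - t * (2 * A * w)) * (2 * A * s - t * (2 * A * v))"
    unfolding w v using assms(2-4) F0 by algebra
  also have "\<dots> = 4 * A * (A * (s - t * w) * (s - t * v))" by algebra
  finally show ?thesis unfolding kowF_hom_quadratic_s using A
    by (simp flip: A_def w_def v_def)
qed

lemma kow_root_differentiable:
  assumes "r1 holomorphic_on V1" "r2 holomorphic_on V2" "open V1" "open V2" "x1 \<in> V1" "x2 \<in> V2" "x1 \<noteq> x2"
  shows "kow_root a \<epsilon> r1 r2 differentiable (at (x1, x2))"
proof -
  have 1: "(\<lambda>z. r1 (fst z)) differentiable (at (x1, x2))"
  proof -
    obtain d where "(r1 has_field_derivative d) (at x1)"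
      using assms holomorphic_on_imp_differentiable_at unfolding field_differentiable_def by blast
    then have "(r1 has_derivative (*) d) (at (fst (x1, x2)))" by (simp add: has_field_derivative_def)
    then show ?thesis
      unfolding differentiable_def using has_derivative_compose[OF has_derivative_fst[OF has_derivative_ident]] by blast
  qed
  have 2: "(\<lambda>z. r2 (snd z)) differentiable (at (x1, x2))"
  proof -
    obtain d where "(r2 has_field_derivative d) (at x2)"
      using assms holomorphic_on_imp_differentiable_at unfolding field_differentiable_def by blast
    then have "(r2 has_derivative (*) d) (at (snd (x1, x2)))" by (simp add: has_field_derivative_def)
    then show ?thesis
      unfolding differentiable_def using has_derivative_compose[OF has_derivative_snd[OF has_derivative_ident]] by blast
  qed
  have fs: "fst differentiable (at (x1, x2))" "snd differentiable (at (x1, x2))"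
    unfolding differentiable_def using has_derivative_fst has_derivative_snd has_derivative_ident by blast+
  have "(\<lambda>z. (- kow_linear a (fst z) (snd z) - \<epsilon> * r1 (fst z) * r2 (snd z)) / (2 * (fst z - snd z)\<^sup>2)) differentiable (at (x1, x2))"
    unfolding kow_linear_def using assms(7)
    by (intro differentiable_divide differentiable_diff differentiable_minus differentiable_add differentiable_mult
        differentiable_power differentiable_const 1 2 fs) auto
  moreover have "kow_root a \<epsilon> r1 r2 = (\<lambda>z. (- kow_linear a (fst z) (snd z) - \<epsilon> * r1 (fst z) * r2 (snd z)) / (2 * (fst z - snd z)\<^sup>2))"
    by (auto simp: kow_root_def)
  ultimately show ?thesis by simp
qed

text \<open>At the root \<open>w\<close> one has \<open>F\<^sub>s = - \<epsilon> r1 r2\<close>, hence \<open>F\<^sub>1 F\<^sub>2 = J(w) r1 r2\<close> by \<open>kow_dx_mult\<close>. So if the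
  branch \<open>q\<close> of \<open>sqrt J\<close> is chosen with \<open>F\<^sub>1 = \<epsilon> r2 q\<close>, then \<open>F\<^sub>2 = \<epsilon> r1 q\<close> follows, and
  \<open>dF = \<epsilon> r1 r2 q (dx1 / r1 + dx2 / r2 - ds / q)\<close>. The pullback of \<open>dF\<close> to the graph of \<open>w\<close> is zero,
  which is the differential relation.\<close>

lemma kowalevski_branch:
  fixes a :: "nat \<Rightarrow> complex" and P J :: "complex poly"
  assumes \<epsilon>: "\<epsilon>\<^sup>2 = 1" and P: "\<And>x. poly P x = \<epsilon> * pencil_quartic a x" and J: "\<And>s. poly J s = \<epsilon> * pencil_cubic a s"
    and r1: "sqrt_branch P V1 r1" and r2: "sqrt_branch P V2 r2"
    and V: "connected V1" "connected V2" "V1 \<inter> V2 = {}"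
    and W: "open W" "contractible W" "\<And>s. s \<in> W \<Longrightarrow> poly J s \<noteq> 0"
    and w: "\<And>x1 x2. x1 \<in> V1 \<Longrightarrow> x2 \<in> V2 \<Longrightarrow> kow_root a \<epsilon> r1 r2 (x1, x2) \<in> W"
    and w': "\<And>x1 x2. x1 \<in> V1 \<Longrightarrow> x2 \<in> V2 \<Longrightarrow> kow_root a (- \<epsilon>) r1 r2 (x1, x2) \<notin> W"
  shows "\<exists>q. sqrt_branch J W q \<and>
    (\<forall>x1\<in>V1. \<forall>x2\<in>V2. differential_relation (form_plus r1 r2) q (kow_root a \<epsilon> r1 r2) x1 x2) \<and>
    infinitesimal_form_of_action a V1 V2 W (form_plus r1 r2) q (kow_root a \<epsilon> r1 r2)"
proof -
  let ?w = "kow_root a \<epsilon> r1 r2"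
  have \<epsilon>0: "\<epsilon> \<noteq> 0" using \<epsilon> by auto
  have op: "open V1" "open V2" and hol: "r1 holomorphic_on V1" "r2 holomorphic_on V2"
    using r1 r2 by (auto simp: sqrt_branch_def)
  have R1: "r1 x \<noteq> 0" "(r1 x)\<^sup>2 = \<epsilon> * pencil_quartic a x" if "x \<in> V1" for x
    using r1 that P by (auto simp: sqrt_branch_def)
  have R2: "r2 x \<noteq> 0" "(r2 x)\<^sup>2 = \<epsilon> * pencil_quartic a x" if "x \<in> V2" for x
    using r2 that P by (auto simp: sqrt_branch_def)
  have ne: "x1 \<noteq> x2" if "x1 \<in> V1" "x2 \<in> V2" for x1 x2 using that V(3) by auto
  have zero: "kowF a s x1 x2 = 0 \<longleftrightarrow> s = ?w (x1, x2) \<or> s = kow_root a (- \<epsilon>) r1 r2 (x1, x2)"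
    if x: "x1 \<in> V1" "x2 \<in> V2" for s x1 x2
    using kowF_hom_factor[of x1 x2 \<epsilon> r1 a r2 s 1] ne[OF x] \<epsilon> R1(2)[OF x(1)] R2(2)[OF x(2)]
    by (simp add: kowF_hom_finite)
  obtain h where h: "h holomorphic_on W" "\<And>s. s \<in> W \<Longrightarrow> poly J s = (h s)\<^sup>2"
  proof (rule contractible_imp_holomorphic_sqrt[of "poly J" W])
    show "poly J holomorphic_on W" by (intro poly_holomorphic_on holomorphic_intros)
  qed (use W in auto)
  have h0: "h s \<noteq> 0" if "s \<in> W" for s using h(2) W(3) that by fastforce
  have wcont: "continuous_on (V1 \<times> V2) ?w"
  proof (rule continuous_at_imp_continuous_on, safe)
    fix x1 x2 assume "x1 \<in> V1" "x2 \<in> V2"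
    then show "isCont ?w (x1, x2)"
      using kow_root_differentiable[OF hol op] ne differentiable_imp_continuous_within by blast
  qed
  \<comment> \<open>The sign by which an arbitrary branch \<open>h\<close> of \<open>sqrt J\<close> fails to satisfy \<open>F\<^sub>1 = \<epsilon> r2 h\<close>.
    It is continuous in \<open>(x1, x2)\<close>, hence constant.\<close>
  define c where "c = (\<lambda>z. kow_dx a (?w z) (fst z) (snd z) * \<epsilon> / (r2 (snd z) * h (?w z)))"
  have c2: "(c (x1, x2))\<^sup>2 = 1" if x: "x1 \<in> V1" "x2 \<in> V2" for x1 x2
  proof -
    have "(kow_dx a (?w (x1, x2)) x1 x2)\<^sup>2 = pencil_cubic a (?w (x1, x2)) * pencil_quartic a x2"
      using kow_dx_sq[of a "?w (x1, x2)" x1 x2] zero[OF x] by simp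
    moreover have "(r2 x2 * h (?w (x1, x2)))\<^sup>2 = (\<epsilon> * pencil_quartic a x2) * (\<epsilon> * pencil_cubic a (?w (x1, x2)))"
      using R2(2)[OF x(2)] h(2)[OF w[OF x]] J by (simp add: power_mult_distrib)
    ultimately have "(kow_dx a (?w (x1, x2)) x1 x2 * \<epsilon>)\<^sup>2 = (r2 x2 * h (?w (x1, x2)))\<^sup>2" 
      by algebra
    moreover have "r2 x2 * h (?w (x1, x2)) \<noteq> 0" using R2(1)[OF x(2)] h0[OF w[OF x]] by simp
    ultimately show ?thesis by (simp add: c_def power_divide)
  qed
  have "c constant_on (V1 \<times> V2)"
  proof (rule continuous_finite_range_constant)
    show "connected (V1 \<times> V2)" using V by (intro connected_Times)
    have h': "continuous_on (V1 \<times> V2) (\<lambda>z. h (?w z))"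
      by (rule continuous_on_compose2[OF holomorphic_on_imp_continuous_on[OF h(1)] wcont]) (use w in auto)
    have r': "continuous_on (V1 \<times> V2) (\<lambda>z. r2 (snd z))"
      by (rule continuous_on_compose2[OF holomorphic_on_imp_continuous_on[OF hol(2)]]) (auto intro!: continuous_intros)
    show "continuous_on (V1 \<times> V2) c"
      unfolding c_def kow_dx_def kow_coeff2_def kow_coeff1_def
      by (intro continuous_intros wcont h' r') (use R2(1) h0 w in auto)
    have "c ` (V1 \<times> V2) \<subseteq> {1, -1}" using c2 by (auto simp: power2_eq_1_iff)
    then show "finite (c ` (V1 \<times> V2))" using finite_subset by blast
  qed
  then obtain k where k: "\<And>x1 x2. x1 \<in> V1 \<Longrightarrow> x2 \<in> V2 \<Longrightarrow> c (x1, x2) = k"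
    unfolding constant_on_def by auto
  show ?thesis
  proof (cases "V1 \<times> V2 = {}")
    case True
    then have "sqrt_branch J W h" using W h h0 by (auto simp: sqrt_branch_def)
    with True show ?thesis by (auto simp: infinitesimal_form_of_action_def)
  next
    case False
    then have k2: "k\<^sup>2 = 1" using c2 k by force
    define q where "q = (\<lambda>s. k * h s)"
    have q: "sqrt_branch J W q"
      using W h h0 k2 by (auto simp: sqrt_branch_def q_def power_mult_distrib intro!: holomorphic_intros)
    have q0: "q s \<noteq> 0" "(q s)\<^sup>2 = \<epsilon> * pencil_cubic a s" if "s \<in> W" for s
      using q that J by (auto simp: sqrt_branch_def)
    have D1: "kow_dx a (?w (x1, x2)) x1 x2 = \<epsilon> * r2 x2 * q (?w (x1, x2))"
      if x: "x1 \<in> V1" "x2 \<in> V2" for x1 x2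
    proof -
      have "kow_dx a (?w (x1, x2)) x1 x2 * \<epsilon> = k * (r2 x2 * h (?w (x1, x2)))"
        using k[OF x] R2(1)[OF x(2)] h0[OF w[OF x]] by (simp add: c_def field_simps)
      then show ?thesis using \<epsilon> unfolding q_def by algebra
    qed
    have D2: "kow_dx a (?w (x1, x2)) x2 x1 = \<epsilon> * r1 x1 * q (?w (x1, x2))"
      if x: "x1 \<in> V1" "x2 \<in> V2" for x1 x2
    proof -
      have "kow_dx a (?w (x1, x2)) x1 x2 * kow_dx a (?w (x1, x2)) x2 x1 = - pencil_cubic a (?w (x1, x2)) * (- \<epsilon> * r1 x1 * r2 x2)"
        using kow_dx_mult zero[OF x] kow_ds_root[OF ne[OF x]] by metis
      then have "\<epsilon> * r2 x2 * q (?w (x1, x2)) * kow_dx a (?w (x1, x2)) x2 x1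
         = \<epsilon> * r2 x2 * q (?w (x1, x2)) * (\<epsilon> * r1 x1 * q (?w (x1, x2)))"
        unfolding D1[OF x] using q0(2)[OF w[OF x]] \<epsilon> by algebra
      then show ?thesis using \<epsilon>0 R2(1)[OF x(2)] q0(1)[OF w[OF x]] by simp
    qed
    define \<kappa> where "\<kappa> = (\<lambda>x1 x2. \<epsilon> * r1 x1 * r2 x2 * q (?w (x1, x2)))"
    have \<kappa>0: "\<kappa> x1 x2 \<noteq> 0" if x: "x1 \<in> V1" "x2 \<in> V2" for x1 x2
      using \<epsilon>0 R1(1)[OF x(1)] R2(1)[OF x(2)] q0(1)[OF w[OF x]] by (simp add: \<kappa>_def)
    have der: "((\<lambda>(s, x1, x2). kowF a s x1 x2) has_derivative
        (\<lambda>(k, h1, h2). \<kappa> x1 x2 * (form_plus r1 r2 x1 x2 h1 h2 - k / q (?w (x1, x2))))) (at (?w (x1, x2), x1, x2))"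
      if x: "x1 \<in> V1" "x2 \<in> V2" for x1 x2
    proof -
      have "(\<lambda>(k, h1, h2). kow_ds a (?w (x1, x2)) x1 x2 * k + kow_dx a (?w (x1, x2)) x1 x2 * h1 + kow_dx a (?w (x1, x2)) x2 x1 * h2)
        = (\<lambda>(k, h1, h2). \<kappa> x1 x2 * (form_plus r1 r2 x1 x2 h1 h2 - k / q (?w (x1, x2))))"
        using \<epsilon>0 R1(1)[OF x(1)] R2(1)[OF x(2)] q0(1)[OF w[OF x]]
        unfolding kow_ds_root[OF ne[OF x]] D1[OF x] D2[OF x] \<kappa>_def form_plus_def
        by (auto simp: fun_eq_iff field_simps)
      then show ?thesis using kowF_has_derivative[of a "?w (x1, x2)" x1 x2] by simp
    qed
    have "differential_relation (form_plus r1 r2) q ?w x1 x2" if x: "x1 \<in> V1" "x2 \<in> V2" for x1 x2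
    proof -
      obtain D where D: "(?w has_derivative D) (at (x1, x2))"
        using kow_root_differentiable[OF hol op x ne[OF x]] unfolding differentiable_def by blast
      have "((\<lambda>z. (?w z, fst z, snd z)) has_derivative (\<lambda>h. (D h, fst h, snd h))) (at (x1, x2))"
        by (intro has_derivative_Pair D has_derivative_fst has_derivative_snd has_derivative_ident)
      from has_derivative_compose[OF this, unfolded fst_conv snd_conv, OF der[OF x]]
      have "((\<lambda>z. kowF a (?w z) (fst z) (snd z)) has_derivative
         (\<lambda>h. \<kappa> x1 x2 * (form_plus r1 r2 x1 x2 (fst h) (snd h) - D h / q (?w (x1, x2))))) (at (x1, x2))"
        by (simp add: case_prod_unfold)
      moreover have "((\<lambda>z. kowF a (?w z) (fst z) (snd z)) has_derivative (\<lambda>h. 0)) (at (x1, x2))"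
        by (rule has_derivative_transform_within_open[of "\<lambda>z. 0" _ _ _ "V1 \<times> V2"])
           (use x op zero in \<open>auto intro: open_Times\<close>)
      ultimately have "(\<lambda>h. \<kappa> x1 x2 * (form_plus r1 r2 x1 x2 (fst h) (snd h) - D h / q (?w (x1, x2)))) = (\<lambda>h. 0)"
        by (rule has_derivative_unique)
      then have "form_plus r1 r2 x1 x2 h1 h2 = D (h1, h2) / q (?w (x1, x2))" for h1 h2
        using \<kappa>0[OF x] by (auto simp: fun_eq_iff)
      with D show ?thesis unfolding differential_relation_def by blast
    qed
    moreover have "infinitesimal_form_of_action a V1 V2 W (form_plus r1 r2) q ?w"
      unfolding infinitesimal_form_of_action_def
    proof (intro ballI conjI impI)
      fix x1 x2 s assume x: "x1 \<in> V1" "x2 \<in> V2" and s: "s \<in> W"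
      have "pencil_cubic a s \<noteq> 0" "pencil_quartic a x1 \<noteq> 0" using W(3)[OF s] J R1[OF x(1)] by auto
      then show "(\<exists>R. coset_action a (Fin s) (Fin x1) R \<and> Fin x2 \<in># R) \<longleftrightarrow> s = ?w (x1, x2)"
        unfolding coset_action_graph[OF \<open>pencil_cubic a s \<noteq> 0\<close> \<open>pencil_quartic a x1 \<noteq> 0\<close>] zero[OF x] using w'[OF x] s by auto
      assume "s = ?w (x1, x2)"
      then show "\<exists>\<kappa>. \<kappa> \<noteq> 0 \<and> ((\<lambda>(s, x1, x2). kowF a s x1 x2) has_derivative
                (\<lambda>(k, h1, h2). \<kappa> * (form_plus r1 r2 x1 x2 h1 h2 - k / q s))) (at (s, x1, x2))"
        using \<kappa>0[OF x] der[OF x] by blast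
    qed
    ultimately show ?thesis using q by blast
  qed
qed

text \<open>The two roots at \<open>(u1, u2)\<close> are distinct, as the discriminant \<open>P(u1) P(u2)\<close> is nonzero, so they have
  disjoint neighbourhoods \<open>W1\<close>, \<open>W2\<close> without zeros of \<open>J\<close>; the neighbourhoods of \<open>u1\<close> and \<open>u2\<close> are
  shrunk until the roots stay there. The statement about the second root is the one about the first
  root with \<open>- r2\<close> in place of \<open>r2\<close>.\<close>

lemma kowalevski_local:
  fixes a :: "nat \<Rightarrow> complex" and P J :: "complex poly"
  assumes \<epsilon>: "\<epsilon>\<^sup>2 = 1" and P: "\<And>x. poly P x = \<epsilon> * pencil_quartic a x" and J: "\<And>s. poly J s = \<epsilon> * pencil_cubic a s"
    and u: "poly P u1 \<noteq> 0" "poly P u2 \<noteq> 0" "u1 \<noteq> u2" "\<And>s. kowF a s u1 u2 = 0 \<Longrightarrow> poly J s \<noteq> 0"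
  shows "\<exists>V1 V2 W1 W2 r1 r2 q1 q2 w1 w2.
           u1 \<in> V1 \<and> u2 \<in> V2 \<and>
           kowalevski_change a P J V1 V2 W1 W2 r1 r2 q1 q2 w1 w2 \<and>
           infinitesimal_form_of_action a V1 V2 W1 (form_plus r1 r2) q1 w1 \<and>
           infinitesimal_form_of_action a V1 V2 W2 (form_minus r1 r2) q2 w2"
proof -
  have opn: "open {z. poly Q z \<noteq> 0}" for Q :: "complex poly"
    by (intro open_Collect_neq continuous_intros)
  have shrink: "\<exists>e>0. ball z e \<subseteq> S" if "open S" "z \<in> S" for S and z :: complex
    using that open_contains_ball by blast
  have branch: "\<exists>r. sqrt_branch P (ball z e) r" if "ball z e \<subseteq> {z. poly P z \<noteq> 0}" for z e
  proof -
    have "poly P holomorphic_on ball z e" by (intro poly_holomorphic_on holomorphic_intros)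
    moreover have "contractible (ball z e)" by (simp add: convex_imp_contractible)
    moreover have "poly P y \<noteq> 0" if "y \<in> ball z e" for y
      using that \<open>ball z e \<subseteq> _\<close> by auto
    ultimately obtain r where r: "r holomorphic_on ball z e" "\<And>y. y \<in> ball z e \<Longrightarrow> poly P y = (r y)\<^sup>2"
      by (rule contractible_imp_holomorphic_sqrt) (assumption | rule that)+
    then have "\<forall>y\<in>ball z e. r y \<noteq> 0"
      using \<open>\<And>y. y \<in> ball z e \<Longrightarrow> poly P y \<noteq> 0\<close> by fastforce
    with r show ?thesis unfolding sqrt_branch_def by (intro exI[of _ r]) auto
  qed
  obtain U1 U2 where U: "open U1" "open U2" "u1 \<in> U1" "u2 \<in> U2" "U1 \<inter> U2 = {}"
    using hausdorff[OF u(3)] by blast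
  obtain e1 where e1: "e1 > 0" "ball u1 e1 \<subseteq> U1 \<inter> {z. poly P z \<noteq> 0}"
    using shrink[of "U1 \<inter> {z. poly P z \<noteq> 0}" u1] U opn u by blast
  obtain e2 where e2: "e2 > 0" "ball u2 e2 \<subseteq> U2 \<inter> {z. poly P z \<noteq> 0}"
    using shrink[of "U2 \<inter> {z. poly P z \<noteq> 0}" u2] U opn u by blast
  obtain r1 where r1: "sqrt_branch P (ball u1 e1) r1" using branch[of u1 e1] e1 by auto
  obtain r2 where r2: "sqrt_branch P (ball u2 e2) r2" using branch[of u2 e2] e2 by auto
  define w1 w2 where "w1 = kow_root a \<epsilon> r1 r2" and "w2 = kow_root a (- \<epsilon>) r1 r2"
  have disj: "ball u1 e1 \<inter> ball u2 e2 = {}" using e1 e2 U by blast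
  have R: "r1 x1 \<noteq> 0" "(r1 x1)\<^sup>2 = \<epsilon> * pencil_quartic a x1" "r2 x2 \<noteq> 0" "(r2 x2)\<^sup>2 = \<epsilon> * pencil_quartic a x2" "x1 \<noteq> x2"
    if "x1 \<in> ball u1 e1" "x2 \<in> ball u2 e2" for x1 x2
    using that r1 r2 P disj by (auto simp: sqrt_branch_def)
  have fact: "kowF_hom a s t x1 1 x2 1 = (x1 - x2)\<^sup>2 * (s - t * w1 (x1, x2)) * (s - t * w2 (x1, x2))"
    if "x1 \<in> ball u1 e1" "x2 \<in> ball u2 e2" for x1 x2 s t
    using kowF_hom_factor R[OF that] \<epsilon> unfolding w1_def w2_def by blast
  have uV: "u1 \<in> ball u1 e1" "u2 \<in> ball u2 e2" using e1 e2 by auto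
  have neq: "w1 (u1, u2) \<noteq> w2 (u1, u2)"
  proof
    assume "w1 (u1, u2) = w2 (u1, u2)"
    then have "\<epsilon> * r1 u1 * r2 u2 = 0" using R[OF uV]
      by (simp add: w1_def w2_def kow_root_def)
    then show False using R[OF uV] \<epsilon> by auto
  qed
  have J0: "poly J (w1 (u1, u2)) \<noteq> 0" "poly J (w2 (u1, u2)) \<noteq> 0"
    using u(4) fact[OF uV, of _ 1] by (auto simp: kowF_hom_finite)
  obtain Y1 Y2 where Y: "open Y1" "open Y2" "w1 (u1, u2) \<in> Y1" "w2 (u1, u2) \<in> Y2" "Y1 \<inter> Y2 = {}"
    using hausdorff[OF neq] by blast
  obtain d1 where d1: "d1 > 0" "ball (w1 (u1, u2)) d1 \<subseteq> Y1 \<inter> {z. poly J z \<noteq> 0}"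
    using shrink[of "Y1 \<inter> {z. poly J z \<noteq> 0}" "w1 (u1, u2)"] Y opn J0 by blast
  obtain d2 where d2: "d2 > 0" "ball (w2 (u1, u2)) d2 \<subseteq> Y2 \<inter> {z. poly J z \<noteq> 0}"
    using shrink[of "Y2 \<inter> {z. poly J z \<noteq> 0}" "w2 (u1, u2)"] Y opn J0 by blast
  define W1 W2 where "W1 = ball (w1 (u1, u2)) d1" and "W2 = ball (w2 (u1, u2)) d2"
  have WW: "W1 \<inter> W2 = {}" using d1 d2 Y unfolding W1_def W2_def by blast
  have cont: "continuous_on (ball u1 e1 \<times> ball u2 e2) (kow_root a \<delta> r1 r2)" for \<delta>
  proof (rule continuous_at_imp_continuous_on, safe)
    fix x1 x2 assume "x1 \<in> ball u1 e1" "x2 \<in> ball u2 e2"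
    then show "isCont (kow_root a \<delta> r1 r2) (x1, x2)"
      using kow_root_differentiable[of r1 "ball u1 e1" r2 "ball u2 e2"] R(5) r1 r2 differentiable_imp_continuous_within
      unfolding sqrt_branch_def by blast
  qed
  define T where "T = (ball u1 e1 \<times> ball u2 e2) \<inter> w1 -` W1 \<inter> ((ball u1 e1 \<times> ball u2 e2) \<inter> w2 -` W2)"
  have "open ((ball u1 e1 \<times> ball u2 e2) \<inter> kow_root a \<delta> r1 r2 -` ball z d)" for \<delta> z d
    by (rule continuous_open_preimage[OF cont]) (auto intro: open_Times)
  then have "open T" unfolding T_def w1_def w2_def W1_def W2_def by (intro open_Int[of "_ \<inter> _"])
  moreover have "(u1, u2) \<in> T" using uV d1 d2 by (simp add: T_def W1_def W2_def)
  ultimately obtain A1 A2 where A: "open A1" "open A2" "u1 \<in> A1" "u2 \<in> A2" "A1 \<times> A2 \<subseteq> T"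
    by (auto elim!: open_prod_elim)
  obtain c1 where c1: "c1 > 0" "ball u1 c1 \<subseteq> A1" using shrink A by blast
  obtain c2 where c2: "c2 > 0" "ball u2 c2 \<subseteq> A2" using shrink A by blast
  define V1 V2 where "V1 = ball u1 c1" and "V2 = ball u2 c2"
  have VT: "V1 \<times> V2 \<subseteq> T" using A c1 c2 unfolding V1_def V2_def by blast
  have u': "u1 \<in> V1" "u2 \<in> V2" using c1 c2 by (auto simp: V1_def V2_def)
  have sub: "V1 \<subseteq> ball u1 e1" "V2 \<subseteq> ball u2 e2" using VT u' unfolding T_def by blast+
  have wV: "w1 (x1, x2) \<in> W1" "w2 (x1, x2) \<in> W2" if "x1 \<in> V1" "x2 \<in> V2" for x1 x2
    using VT that unfolding T_def by blast+
  have r1': "sqrt_branch P V1 r1" using r1 sub holomorphic_on_subset unfolding sqrt_branch_def V1_def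
    by (meson open_ball subsetD)
  have r2': "sqrt_branch P V2 r2" using r2 sub holomorphic_on_subset unfolding sqrt_branch_def V2_def
    by (meson open_ball subsetD)
  then have r2m: "sqrt_branch P V2 (\<lambda>z. - r2 z)"
    by (auto simp: sqrt_branch_def intro: holomorphic_on_minus)
  have Vc: "connected V1" "connected V2" "V1 \<inter> V2 = {}"
    using disj sub by (auto simp: V1_def V2_def)
  have Wc: "open W1" "contractible W1" "open W2" "contractible W2"
     "\<And>s. s \<in> W1 \<Longrightarrow> poly J s \<noteq> 0" "\<And>s. s \<in> W2 \<Longrightarrow> poly J s \<noteq> 0"
    using d1 d2 by (auto simp: W1_def W2_def convex_imp_contractible)
  have minus: "kow_root a \<epsilon> r1 (\<lambda>z. - r2 z) = w2" "kow_root a (- \<epsilon>) r1 (\<lambda>z. - r2 z) = w1"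
    "form_plus r1 (\<lambda>z. - r2 z) = form_minus r1 r2"
    by (auto simp: w1_def w2_def kow_root_def form_plus_def form_minus_def fun_eq_iff)
  obtain q1 where q1: "sqrt_branch J W1 q1"
    "\<forall>x1\<in>V1. \<forall>x2\<in>V2. differential_relation (form_plus r1 r2) q1 w1 x1 x2"
    "infinitesimal_form_of_action a V1 V2 W1 (form_plus r1 r2) q1 w1"
    using kowalevski_branch[OF \<epsilon> P J r1' r2' Vc Wc(1,2,5), folded w1_def w2_def] wV WW by blast
  obtain q2 where q2: "sqrt_branch J W2 q2"
    "\<forall>x1\<in>V1. \<forall>x2\<in>V2. differential_relation (form_minus r1 r2) q2 w2 x1 x2"
    "infinitesimal_form_of_action a V1 V2 W2 (form_minus r1 r2) q2 w2"
    using kowalevski_branch[OF \<epsilon> P J r1' r2m Vc Wc(3,4,6), unfolded minus] wV WW by blast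
  have "kow_roots a (Fin x1) (Fin x2) {# Fin (w1 (x1, x2)), Fin (w2 (x1, x2)) #}"
    if x: "x1 \<in> V1" "x2 \<in> V2" for x1 x2
  proof -
    have "(x1 - x2)\<^sup>2 \<noteq> 0" using x Vc by auto
    moreover have "x1 \<in> ball u1 e1" "x2 \<in> ball u2 e2" using x sub by auto
    ultimately show ?thesis unfolding kow_roots_def root_pair_def
      using fact by (intro exI[of _ "Fin (w1 (x1, x2))"] exI[of _ "Fin (w2 (x1, x2))"] exI[of _ "(x1 - x2)\<^sup>2"]) simp
  qed
  then have "kowalevski_change a P J V1 V2 W1 W2 r1 r2 q1 q2 w1 w2"
    using r1' r2' q1 q2 wV unfolding kowalevski_change_def by blast
  then show ?thesis using u' q1(3) q2(3) by blast
qed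

theorem theorem5:
  fixes a :: "nat \<Rightarrow> complex" and P J :: "complex poly"
  assumes "degree P = 4" and "card {x. poly P x = 0} = 4"
    and "degree J = 3"
    and "\<And>x1 x2. discriminant (\<lambda>s. kowF a s x1 x2) = poly P x1 * poly P x2"
    and "\<And>s x1. discriminant (\<lambda>x2. kowF a s x1 x2) = poly J s * poly P x1"
  shows
    "(\<forall>x1 x2. poly P x1 \<noteq> 0 \<and> poly P x2 \<noteq> 0 \<and> x1 \<noteq> x2 \<and>
        (\<forall>s. kowF a s x1 x2 = 0 \<longrightarrow> poly J s \<noteq> 0) \<longrightarrow>
        (\<exists>V1 V2 W1 W2 r1 r2 q1 q2 w1 w2.
           x1 \<in> V1 \<and> x2 \<in> V2 \<and>
           kowalevski_change a P J V1 V2 W1 W2 r1 r2 q1 q2 w1 w2 \<and>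
           infinitesimal_form_of_action a V1 V2 W1 (form_plus r1 r2) q1 w1 \<and>
           infinitesimal_form_of_action a V1 V2 W2 (form_minus r1 r2) q2 w2)) \<and>
     (\<exists>\<psi> \<alpha> \<beta> g2 g3.
        fractional_linear \<psi> \<and> \<alpha> \<noteq> 0 \<and> g2 ^ 3 \<noteq> 27 * g3\<^sup>2 \<and>
        (\<forall>m. poly J (\<alpha> * m + \<beta>) = canonical_cubic g2 g3 m) \<and>
        (\<forall>\<xi>1 \<xi>2. kow_roots a (\<psi> \<xi>1) (\<psi> \<xi>2)
           (image_mset (affine_map \<alpha> \<beta>) (coset_op g2 g3 \<xi>1 \<xi>2))) \<and>
        (\<forall>\<omega> \<xi>. coset_action a (affine_map \<alpha> \<beta> \<omega>) (\<psi> \<xi>)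
           (image_mset \<psi> (coset_op g2 g3 \<omega> \<xi>))))"
proof -
  have "P \<noteq> 0" using assms(1) by auto
  then obtain \<epsilon> where \<epsilon>: "\<epsilon>\<^sup>2 = 1" "\<And>x. poly P x = \<epsilon> * pencil_quartic a x" "\<And>s. poly J s = \<epsilon> * pencil_cubic a s"
    using quartic_and_cubic_up_to_sign[OF assms(4,5)] by metis
  then have \<epsilon>0: "\<epsilon> \<noteq> 0" by auto
  then have "card {x. pencil_quartic a x = 0} = 4" using assms(2) by (simp add: \<epsilon>(2))
  then obtain \<psi> \<beta> g2 g3 where G: "fractional_linear \<psi>" "g2 ^ 3 \<noteq> 27 * g3\<^sup>2"
     "\<forall>m. \<epsilon> * pencil_cubic a (\<epsilon> * m + \<beta>) = canonical_cubic g2 g3 m"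
     "\<forall>\<xi>1 \<xi>2. kow_roots a (\<psi> \<xi>1) (\<psi> \<xi>2) (image_mset (affine_map \<epsilon> \<beta>) (coset_op g2 g3 \<xi>1 \<xi>2))"
     "\<forall>\<omega> \<xi>. coset_action a (affine_map \<epsilon> \<beta> \<omega>) (\<psi> \<xi>) (image_mset \<psi> (coset_op g2 g3 \<omega> \<xi>))"
    using kowalevski_coset_group[OF _ \<epsilon>(1)] by metis
  show ?thesis
  proof (intro conjI allI impI)
    show "\<exists>V1 V2 W1 W2 r1 r2 q1 q2 w1 w2.
           x1 \<in> V1 \<and> x2 \<in> V2 \<and>
           kowalevski_change a P J V1 V2 W1 W2 r1 r2 q1 q2 w1 w2 \<and>
           infinitesimal_form_of_action a V1 V2 W1 (form_plus r1 r2) q1 w1 \<and>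
           infinitesimal_form_of_action a V1 V2 W2 (form_minus r1 r2) q2 w2"
      if "poly P x1 \<noteq> 0 \<and> poly P x2 \<noteq> 0 \<and> x1 \<noteq> x2 \<and> (\<forall>s. kowF a s x1 x2 = 0 \<longrightarrow> poly J s \<noteq> 0)" for x1 x2
      using that by (intro kowalevski_local[OF \<epsilon>]) auto
    show "\<exists>\<psi> \<alpha> \<beta> g2 g3.
        fractional_linear \<psi> \<and> \<alpha> \<noteq> 0 \<and> g2 ^ 3 \<noteq> 27 * g3\<^sup>2 \<and>
        (\<forall>m. poly J (\<alpha> * m + \<beta>) = canonical_cubic g2 g3 m) \<and>
        (\<forall>\<xi>1 \<xi>2. kow_roots a (\<psi> \<xi>1) (\<psi> \<xi>2)
           (image_mset (affine_map \<alpha> \<beta>) (coset_op g2 g3 \<xi>1 \<xi>2))) \<and>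
        (\<forall>\<omega> \<xi>. coset_action a (affine_map \<alpha> \<beta> \<omega>) (\<psi> \<xi>)
           (image_mset \<psi> (coset_op g2 g3 \<omega> \<xi>)))"
      using G \<epsilon>0 unfolding \<epsilon>(3)[symmetric]
      by (intro exI[of _ \<psi>] exI[of _ \<epsilon>] exI[of _ \<beta>] exI[of _ g2] exI[of _ g3]) simp
  qed
qed

end
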